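(* Let $p$ be a prime and let $\mathbf{F}$ be a field of characteristic $p$. The Hilbert series $\mathcal{H}(\mathbf{F}[V_{p+1}]^{\mathbf{Z}/p^2},x)=\sum_{n\ge 0}\dim_{\mathbf{F}}\left(\mathbf{F}[V_{p+1}]^{\mathbf{Z}/p^2}_n\right)x^n$ of the ring of invariants of the representation $V_{p+1}$ of $\mathbf{Z}/p^2$ is $$\mathcal{H}(\mathbf{F}[V_{p+1}]^{\mathbf{Z}/p^2},x)=\frac{1}{p(1-x^p)}\left(\frac{1}{(1-x)^p}+\frac{(p-1)-px^p+x^{p^2}}{(1-x^p)(1-x^{p^2})}\right).$$
   Context: $V_{p+1}$ is the indecomposable $\mathbf{F}[\mathbf{Z}/p^2]$-module of dimension $p+1$ on which a generator of $\mathbf{Z}/p^2$ acts by a single Jordan block with eigenvalue $1$. $\mathbf{F}[V_{p+1}]:=S(V_{p+1}^* )$ with $\mathbf{Z}/p^2$ acting by algebra automorphisms, graded by polynomial degree. *)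

theory Defs
  imports
    "Jordan_Normal_Form.Jordan_Normal_Form"
    "HOL-Algebra.Elementary_Groups"
    "HOL-Library.Poly_Mapping"
    "HOL-Computational_Algebra.Formal_Power_Series"
    "HOL-Computational_Algebra.Primes"
begin

section \<open>Polynomials in countably many variables\<close>

text \<open>A monomial is its exponent vector, a finitely supported function from variable indices
  to exponents; a polynomial is a finitely supported function from monomials to coefficients.\<close>

type_synonym monom = "nat \<Rightarrow>\<^sub>0 nat"
type_synonym 'a mpoly = "monom \<Rightarrow>\<^sub>0 'a"

definition mconst :: "'a::zero \<Rightarrow> 'a mpoly" where
  "mconst c = Poly_Mapping.single 0 c"

definition mvar :: "nat \<Rightarrow> 'a::zero_neq_one mpoly" where
  "mvar i = Poly_Mapping.single (Poly_Mapping.single i 1) 1"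

definition mscale :: "'a::comm_semiring_1 \<Rightarrow> 'a mpoly \<Rightarrow> 'a mpoly" where
  "mscale c f = mconst c * f"

definition monom_degree :: "monom \<Rightarrow> nat" where
  "monom_degree m = (\<Sum>i\<in>Poly_Mapping.keys m. Poly_Mapping.lookup m i)"

definition homogeneous :: "nat \<Rightarrow> 'a::zero mpoly set" where
  "homogeneous d = {f. \<forall>m\<in>Poly_Mapping.keys f. monom_degree m = d}"

definition poly_ring :: "nat \<Rightarrow> 'a::zero mpoly set" where
  "poly_ring n = {f. \<forall>m\<in>Poly_Mapping.keys f. Poly_Mapping.keys m \<subseteq> {..<n}}"

definition monom_eval :: "(nat \<Rightarrow> 'a::comm_semiring_1 mpoly) \<Rightarrow> monom \<Rightarrow> 'a mpoly" where
  "monom_eval \<sigma> m = (\<Prod>i\<in>Poly_Mapping.keys m. \<sigma> i ^ Poly_Mapping.lookup m i)"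

definition poly_subst :: "(nat \<Rightarrow> 'a::comm_semiring_1 mpoly) \<Rightarrow> 'a mpoly \<Rightarrow> 'a mpoly" where
  "poly_subst \<sigma> f = (\<Sum>m\<in>Poly_Mapping.keys f. mscale (Poly_Mapping.lookup f m) (monom_eval \<sigma> m))"

lemma mconst_simps:
  "mconst 0 = (0 :: 'a::comm_semiring_1 mpoly)"
  "mconst 1 = (1 :: 'a::comm_semiring_1 mpoly)"
  "mconst (a + b) = mconst a + (mconst b :: 'a::comm_semiring_1 mpoly)"
  "mconst (a * b) = mconst a * (mconst b :: 'a::comm_semiring_1 mpoly)"
  by (simp_all add: mconst_def single_add mult_single)

global_interpretation mpoly: vector_space "mscale :: 'a::field \<Rightarrow> 'a mpoly \<Rightarrow> 'a mpoly"
  by unfold_locales (simp_all add: mscale_def mconst_simps algebra_simps)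

definition hilbert_series :: "'a::field mpoly set \<Rightarrow> rat fps" where
  "hilbert_series R = Abs_fps (\<lambda>n. of_nat (mpoly.dim (R \<inter> homogeneous n)))"

lemma monom_eval_superset:
  assumes "finite A" "Poly_Mapping.keys m \<subseteq> A"
  shows "monom_eval \<sigma> m = (\<Prod>i\<in>A. \<sigma> i ^ Poly_Mapping.lookup m i)"
  unfolding monom_eval_def
  by (rule prod.mono_neutral_left) (use assms in \<open>auto simp: in_keys_iff\<close>)

lemma monom_eval_add: "monom_eval \<sigma> (a + b) = monom_eval \<sigma> a * monom_eval \<sigma> b"
proof -
  let ?A = "Poly_Mapping.keys a \<union> Poly_Mapping.keys b"
  have "monom_eval \<sigma> (a + b) = (\<Prod>i\<in>?A. \<sigma> i ^ Poly_Mapping.lookup (a + b) i)"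
    by (rule monom_eval_superset) (auto dest: subsetD[OF Poly_Mapping.keys_add])
  also have "\<dots> = (\<Prod>i\<in>?A. \<sigma> i ^ Poly_Mapping.lookup a i) * (\<Prod>i\<in>?A. \<sigma> i ^ Poly_Mapping.lookup b i)"
    by (simp add: lookup_add power_add prod.distrib)
  also have "\<dots> = monom_eval \<sigma> a * monom_eval \<sigma> b"
    by (simp add: monom_eval_superset[of ?A])
  finally show ?thesis .
qed

lemma poly_subst_superset:
  assumes "finite A" "Poly_Mapping.keys f \<subseteq> A"
  shows "poly_subst \<sigma> f = (\<Sum>m\<in>A. mscale (Poly_Mapping.lookup f m) (monom_eval \<sigma> m))"
  unfolding poly_subst_def
  by (rule sum.mono_neutral_left)
    (use assms in \<open>auto simp: in_keys_iff mscale_def mconst_simps\<close>)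

lemma poly_subst_zero [simp]: "poly_subst \<sigma> 0 = 0"
  by (simp add: poly_subst_def)

lemma poly_subst_add: "poly_subst \<sigma> (f + g) = poly_subst \<sigma> f + poly_subst \<sigma> g"
proof -
  let ?A = "Poly_Mapping.keys f \<union> Poly_Mapping.keys g"
  have "poly_subst \<sigma> (f + g) = (\<Sum>m\<in>?A. mscale (Poly_Mapping.lookup (f + g) m) (monom_eval \<sigma> m))"
    by (rule poly_subst_superset) (auto dest: subsetD[OF Poly_Mapping.keys_add])
  then show ?thesis
    by (simp add: poly_subst_superset[of ?A] lookup_add mscale_def mconst_simps
        distrib_right sum.distrib)
qed

lemma poly_subst_sum: "poly_subst \<sigma> (sum h A) = (\<Sum>i\<in>A. poly_subst \<sigma> (h i))"
  by (induction A rule: infinite_finite_induct) (auto simp: poly_subst_add)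

lemma poly_subst_single:
  "poly_subst \<sigma> (Poly_Mapping.single m c) = mscale c (monom_eval \<sigma> m)"
  by (cases "c = 0") (auto simp: poly_subst_def mscale_def mconst_simps)

lemma mpoly_expand: "f = (\<Sum>m\<in>Poly_Mapping.keys f. Poly_Mapping.single m (Poly_Mapping.lookup f m))"
  by (rule poly_mapping_eqI) (auto simp: lookup_sum lookup_single when_def in_keys_iff)

lemma poly_subst_mult: "poly_subst \<sigma> (f * g) = poly_subst \<sigma> f * poly_subst \<sigma> g"
proof -
  have "f * g = (\<Sum>a\<in>Poly_Mapping.keys f. \<Sum>b\<in>Poly_Mapping.keys g.
      Poly_Mapping.single (a + b) (Poly_Mapping.lookup f a * Poly_Mapping.lookup g b))"
    by (subst mpoly_expand[of f], subst mpoly_expand[of g])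
      (simp add: sum_product mult_single)
  then have "poly_subst \<sigma> (f * g) = (\<Sum>a\<in>Poly_Mapping.keys f. \<Sum>b\<in>Poly_Mapping.keys g.
      mscale (Poly_Mapping.lookup f a * Poly_Mapping.lookup g b) (monom_eval \<sigma> (a + b)))"
    by (simp only: poly_subst_sum poly_subst_single)
  also have "\<dots> = poly_subst \<sigma> f * poly_subst \<sigma> g"
    by (simp add: poly_subst_def sum_product mscale_def mconst_simps monom_eval_add mult_ac)
  finally show ?thesis .
qed

lemma poly_subst_mconst: "poly_subst \<sigma> (mconst c) = mconst c"
  by (simp add: mconst_def poly_subst_single mscale_def monom_eval_def mult_single)

lemma poly_subst_mscale: "poly_subst \<sigma> (mscale c f) = mscale c (poly_subst \<sigma> f)"
  by (simp add: mscale_def poly_subst_mult poly_subst_mconst)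

lemma poly_subst_one [simp]: "poly_subst \<sigma> 1 = 1"
  using poly_subst_mconst[of \<sigma> 1] by (simp add: mconst_simps)

lemma poly_subst_mvar: "poly_subst \<sigma> (mvar i) = \<sigma> i"
  by (simp add: mvar_def poly_subst_single mscale_def mconst_simps monom_eval_def)

lemma poly_subst_power: "poly_subst \<sigma> (f ^ k) = poly_subst \<sigma> f ^ k"
  by (induction k) (auto simp: poly_subst_mult)

lemma poly_subst_prod: "poly_subst \<sigma> (prod h A) = (\<Prod>i\<in>A. poly_subst \<sigma> (h i))"
  by (induction A rule: infinite_finite_induct) (auto simp: poly_subst_mult)

lemma poly_subst_subst: "poly_subst \<sigma> (poly_subst \<tau> f) = poly_subst (\<lambda>i. poly_subst \<sigma> (\<tau> i)) f"
  by (simp add: poly_subst_def[of \<tau>] poly_subst_def[of "\<lambda>i. poly_subst \<sigma> (\<tau> i)"]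
      poly_subst_sum poly_subst_mscale monom_eval_def poly_subst_prod poly_subst_power)

lemma poly_subst_cong:
  assumes "f \<in> poly_ring n" "\<And>i. i < n \<Longrightarrow> \<sigma> i = \<tau> i"
  shows "poly_subst \<sigma> f = poly_subst \<tau> f"
proof -
  have "monom_eval \<sigma> m = monom_eval \<tau> m" if "m \<in> Poly_Mapping.keys f" for m
    unfolding monom_eval_def
  proof (rule prod.cong)
    fix i assume "i \<in> Poly_Mapping.keys m"
    then have "i < n" using assms(1) that by (auto simp: poly_ring_def)
    then show "\<sigma> i ^ Poly_Mapping.lookup m i = \<tau> i ^ Poly_Mapping.lookup m i"
      using assms(2) by simp
  qed simp
  then show ?thesis by (simp add: poly_subst_def)
qed

lemma poly_subst_id: "poly_subst mvar f = (f :: 'a::comm_semiring_1 mpoly)"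
proof -
  have prod_single: "(\<Prod>i\<in>A. Poly_Mapping.single (h i) 1)
      = Poly_Mapping.single (sum h A) (1 :: 'a)" if "finite A" for h :: "nat \<Rightarrow> monom" and A
    using that by (induction A) (auto simp: mult_single)
  have pw: "(mvar i ^ k :: 'a mpoly) = Poly_Mapping.single (Poly_Mapping.single i k) 1" for i k
    by (induction k) (auto simp: mvar_def mult_single single_add[symmetric])
  have "monom_eval mvar m = Poly_Mapping.single m (1 :: 'a)" for m
  proof -
    have "m = (\<Sum>i\<in>Poly_Mapping.keys m. Poly_Mapping.single i (Poly_Mapping.lookup m i))"
      by (rule poly_mapping_eqI) (auto simp: lookup_sum lookup_single when_def in_keys_iff)
    then show ?thesis by (simp add: monom_eval_def pw prod_single)
  qed
  then show ?thesis
    by (simp add: poly_subst_def mscale_def mconst_def mult_single mpoly_expand[symmetric])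
qed

section \<open>The representation and its coordinate ring\<close>

text \<open>The representation space is the space of column vectors of length \<open>p + 1\<close>; the generator
  \<open>1\<close> of the cyclic group acts by a single Jordan block with eigenvalue 1.\<close>

definition V_rep :: "nat \<Rightarrow> int \<Rightarrow> 'a::field mat" where
  "V_rep p g = jordan_block (p + 1) 1 ^\<^sub>m nat g"

text \<open>The variables \<open>x\<^sub>0, \<dots>, x\<^sub>n\<^sub>-\<^sub>1\<close> are the coordinate functions (the dual of the standard
  basis). Precomposing \<open>x\<^sub>i\<close> with \<open>v \<mapsto> A v\<close> gives the linear form below.\<close>

definition coord_pullback :: "nat \<Rightarrow> 'a::field mat \<Rightarrow> nat \<Rightarrow> 'a mpoly" where
  "coord_pullback n A i = (\<Sum>j<n. mscale (A $$ (i, j)) (mvar j))"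

text \<open>On the dual space \<open>g\<close> sends \<open>\<xi>\<close> to \<open>\<xi> \<circ> g\<inverse>\<close>; this extends to algebra automorphisms.\<close>

definition V_act :: "nat \<Rightarrow> int \<Rightarrow> 'a::field mpoly \<Rightarrow> 'a mpoly" where
  "V_act p g = poly_subst
     (coord_pullback (p + 1) (V_rep p (inv\<^bsub>integer_mod_group (p\<^sup>2)\<^esub> g)))"

definition V_invariants :: "nat \<Rightarrow> 'a::field mpoly set" where
  "V_invariants p =
     {f \<in> poly_ring (p + 1). \<forall>g\<in>carrier (integer_mod_group (p\<^sup>2)). V_act p g f = f}"

text \<open>In characteristic \<open>p\<close> these are well-defined actions, since \<open>p + 1 \<le> p\<^sup>2\<close> makes the
  \<open>p\<^sup>2\<close>-th power of the Jordan block trivial.\<close>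

lemma jordan_block_p2:
  assumes "prime p" "CHAR('a::field) = p"
  shows "(jordan_block (p + 1) 1 :: 'a mat) ^\<^sub>m p\<^sup>2 = 1\<^sub>m (p + 1)"
proof -
  have "of_nat (p\<^sup>2 choose k) = (0 :: 'a)" if "0 < k" "k \<le> p" for k
  proof -
    have p2: "p \<ge> 2" using assms(1) by (rule prime_ge_2_nat)
    have "k < p\<^sup>2" using that p2 by (simp add: power2_eq_square)
      (metis One_nat_def Suc_1 Suc_le_lessD le_less_trans less_le_trans mult.right_neutral mult_less_cancel1 not_less)
    have "p dvd (p\<^sup>2 choose k)"
    proof (rule ccontr)
      assume "\<not> p dvd (p\<^sup>2 choose k)"
      then have "coprime (p\<^sup>2) (p\<^sup>2 choose k)"
        using assms(1) by (simp add: prime_imp_coprime)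
      moreover have "k * (p\<^sup>2 choose k) = p\<^sup>2 * (p\<^sup>2 - 1 choose (k - 1))"
        using that by (simp add: times_binomial_minus1_eq)
      ultimately have "p\<^sup>2 dvd k"
        by (metis coprime_dvd_mult_left_iff dvd_triv_left)
      then show False using \<open>k < p\<^sup>2\<close> that by (auto dest: dvd_imp_le)
    qed
    then show ?thesis using assms(2) by (simp add: of_nat_eq_0_iff_char_dvd)
  qed
  then show ?thesis
    unfolding jordan_block_pow by (intro eq_matI) auto
qed

lemma V_rep_carrier [simp]: "V_rep p g \<in> carrier_mat (p + 1) (p + 1)"
  by (simp add: V_rep_def)

lemma V_rep_zero: "V_rep p 0 = 1\<^sub>m (p + 1)"
  by (simp add: V_rep_def jordan_block_def)

lemma V_rep_mult:
  assumes "prime p" "CHAR('a::field) = p"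
    and "g \<in> carrier (integer_mod_group (p\<^sup>2))" "h \<in> carrier (integer_mod_group (p\<^sup>2))"
  shows "(V_rep p (g \<otimes>\<^bsub>integer_mod_group (p\<^sup>2)\<^esub> h) :: 'a mat) = V_rep p g * V_rep p h"
proof -
  let ?J = "jordan_block (p + 1) 1 :: 'a mat"
  let ?R = "ring_mat TYPE('a) (p + 1) ()"
  interpret R: semiring ?R by (rule semiring_mat)
  have J: "?J \<in> carrier_mat (p + 1) (p + 1)" "?J \<in> carrier ?R"
    by (simp_all add: ring_mat_def)
  have pow: "?J ^\<^sub>m k = ?J [^]\<^bsub>?R\<^esub> k" for k
    by (rule pow_mat_ring_pow[OF J(1)])
  have add: "?J ^\<^sub>m (a + b) = ?J ^\<^sub>m a * ?J ^\<^sub>m b" for a b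
    unfolding pow R.nat_pow_mult[OF J(2), symmetric] by (simp add: ring_mat_def)
  have period: "?J ^\<^sub>m (p\<^sup>2 * q) = 1\<^sub>m (p + 1)" for q
  proof -
    have "?J ^\<^sub>m p\<^sup>2 = \<one>\<^bsub>?R\<^esub>"
      using jordan_block_p2[OF assms(1,2)] by (simp add: ring_mat_def)
    then have "(?J [^]\<^bsub>?R\<^esub> p\<^sup>2) [^]\<^bsub>?R\<^esub> q = \<one>\<^bsub>?R\<^esub>"
      unfolding pow by (simp only: R.nat_pow_one)
    then show ?thesis
      unfolding pow R.nat_pow_pow[OF J(2)] by (simp add: ring_mat_def)
  qed
  have modp: "?J ^\<^sub>m (a mod p\<^sup>2) = ?J ^\<^sub>m a" for a
  proof -
    have "?J ^\<^sub>m a = ?J ^\<^sub>m (p\<^sup>2 * (a div p\<^sup>2)) * ?J ^\<^sub>m (a mod p\<^sup>2)"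
      by (simp only: add[symmetric] mult_div_mod_eq)
    then show ?thesis
      unfolding period by simp
  qed
  have "p > 0" using assms(1) by (rule prime_gt_0_nat)
  then have "g \<ge> 0" "h \<ge> 0"
    using assms(3,4) by (auto simp: carrier_integer_mod_group split: if_splits)
  then have "nat ((g + h) mod int (p\<^sup>2)) = (nat g + nat h) mod p\<^sup>2"
    by (simp add: nat_mod_distrib nat_add_distrib nat_power_eq)
  then show ?thesis
    unfolding V_rep_def mult_integer_mod_group by (simp only: modp add)
qed

lemma coord_pullback_one: "i < n \<Longrightarrow> coord_pullback n (1\<^sub>m n :: 'a::field mat) i = mvar i"
proof -
  assume i: "i < n"
  have "coord_pullback n (1\<^sub>m n :: 'a mat) i = (\<Sum>j<n. if i = j then mvar j else 0)"
    unfolding coord_pullback_def using i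
    by (intro sum.cong) (auto simp: mscale_def mconst_simps)
  then show ?thesis using i by simp
qed

lemma coord_pullback_mult:
  assumes "A \<in> carrier_mat n n" "B \<in> carrier_mat n n" "i < n"
  shows "poly_subst (coord_pullback n B) (coord_pullback n A i) = coord_pullback n (A * B) i"
proof -
  have AB: "(A * B) $$ (i, k) = (\<Sum>j<n. A $$ (i, j) * B $$ (j, k))" if "k < n" for k
    using assms that by (simp add: scalar_prod_def atLeast0LessThan)
  have "poly_subst (coord_pullback n B) (coord_pullback n A i)
      = (\<Sum>j<n. \<Sum>k<n. mscale (A $$ (i, j) * B $$ (j, k)) (mvar k))"
    by (simp add: coord_pullback_def poly_subst_sum poly_subst_mscale poly_subst_mvar
        mpoly.scale_sum_right)
  also have "\<dots> = coord_pullback n (A * B) i"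
    unfolding coord_pullback_def
    by (subst sum.swap) (simp add: AB mpoly.scale_sum_left)
  finally show ?thesis .
qed

lemma V_act_one:
  assumes "f \<in> poly_ring (p + 1)" "p > 0"
  shows "V_act p \<one>\<^bsub>integer_mod_group (p\<^sup>2)\<^esub> f = f"
proof -
  have "V_act p \<one>\<^bsub>integer_mod_group (p\<^sup>2)\<^esub> f = poly_subst mvar f"
    unfolding V_act_def using assms
    by (intro poly_subst_cong[OF assms(1)])
      (simp add: carrier_integer_mod_group V_rep_zero coord_pullback_one)
  then show ?thesis by (simp add: poly_subst_id)
qed

lemma V_act_mult:
  assumes "prime p" "CHAR('a::field) = p"
    and g: "g \<in> carrier (integer_mod_group (p\<^sup>2))" and h: "h \<in> carrier (integer_mod_group (p\<^sup>2))"
    and f: "f \<in> poly_ring (p + 1)"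
  shows "V_act p (g \<otimes>\<^bsub>integer_mod_group (p\<^sup>2)\<^esub> h) f = V_act p g (V_act p h (f :: 'a mpoly))"
proof -
  interpret G: group "integer_mod_group (p\<^sup>2)" by simp
  have eq: "(V_rep p (inv\<^bsub>integer_mod_group (p\<^sup>2)\<^esub> (g \<otimes>\<^bsub>integer_mod_group (p\<^sup>2)\<^esub> h)) :: 'a mat)
      = V_rep p (inv\<^bsub>integer_mod_group (p\<^sup>2)\<^esub> h) * V_rep p (inv\<^bsub>integer_mod_group (p\<^sup>2)\<^esub> g)"
    unfolding G.inv_mult_group[OF g h]
    by (rule V_rep_mult[OF assms(1,2) G.inv_closed[OF h] G.inv_closed[OF g]])
  show ?thesis
    unfolding V_act_def poly_subst_subst eq
    by (rule poly_subst_cong[OF f], rule coord_pullback_mult[symmetric, OF V_rep_carrier V_rep_carrier])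
qed

end

theory Submission
  imports Defs
begin

text \<open>
  The generator \<open>\<sigma>\<close> of the group sends the coordinate function \<open>x\<^sub>i\<close> to \<open>x\<^sub>i + x\<^sub>i\<^sub>+\<^sub>1\<close> for
  \<open>i < p\<close> and fixes \<open>x\<^sub>p\<close>. The span of \<open>x\<^sub>1, \<dots>, x\<^sub>p\<close> is a free module of rank one over the group
  algebra of \<open>\<int>/p\<close>, so it has the basis \<open>z\<^sub>i = \<sigma>\<^sup>i x\<^sub>1\<close>, which \<open>\<sigma>\<close> permutes cyclically. With
  \<open>A = F[z\<^sub>0, \<dots>, z\<^sub>p\<^sub>-\<^sub>1]\<close> and \<open>X = x\<^sub>0\<close> the coordinate ring becomes \<open>A[X]\<close>, where \<open>\<sigma>\<close> permutes the
  variables of the coefficients and sends \<open>X\<close> to \<open>X + z\<^sub>0\<close> (\<open>shear_straighten\<close>). The power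
  \<open>\<sigma>\<^sup>p\<close> is then the translation of \<open>X\<close> by \<open>e = z\<^sub>0 + \<dots> + z\<^sub>p\<^sub>-\<^sub>1\<close>, and the polynomial
  \<open>Y = X\<^sup>p - e\<^sup>p\<^sup>-\<^sup>1 X\<close> is invariant under it, while \<open>\<sigma> Y = Y + w\<close> with \<open>w = z\<^sub>0\<^sup>p - e\<^sup>p\<^sup>-\<^sup>1 z\<^sub>0\<close>.

  The invariants are counted by their leading terms in \<open>X\<close>. Invariance under \<open>\<sigma>\<^sup>p\<close> forces the
  degree in \<open>X\<close> to be a multiple \<open>p n\<close> of \<open>p\<close>, and the leading coefficient is an element of \<open>A\<close> that
  is invariant under the cyclic permutation, hence a combination of orbit sums of monomials and of
  powers of \<open>u = z\<^sub>0 \<cdots> z\<^sub>p\<^sub>-\<^sub>1\<close>; all orbits that are not fixed points have \<open>p\<close> elements because \<open>p\<close>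
  is prime. The sum of the conjugates of \<open>m Y\<^sup>n\<close> shows that every orbit sum of a monomial \<open>m\<close> occurs
  for every \<open>n\<close>. A power of \<open>u\<close> occurs for all \<open>n\<close> divisible by \<open>p\<close>, through powers of the norm
  of \<open>Y\<close>, and for no other \<open>n\<close>: in an invariant \<open>u\<^sup>k X\<^sup>p\<^sup>n + \<dots>\<close> the next coefficient would make
  \<open>n u\<^sup>k w\<close> a difference \<open>c - \<sigma> c\<close>. Such a difference has coefficient zero at every
  monomial fixed by the permutation, but \<open>u\<^sup>k\<^sup>+\<^sup>1\<close> occurs in \<open>u\<^sup>k w\<close> with the coefficient
  \<open>- (p - 1)!\<close>, which is nonzero in \<open>F\<close>. These are \<open>invariant_with_coord\<close> and
  \<open>invariant_zero_if_coords_zero\<close>; together they give \<open>dim_invariants\<close>.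

  Let \<open>F(x)\<close> count the orbits of length \<open>p\<close> of monomials of \<open>A\<close> by degree. The Hilbert series is
  therefore \<open>F(x) / (1 - x\<^sup>p) + 1 / ((1 - x\<^sup>p) (1 - x\<^bsup>p\<^sup>2\<^esup>))\<close>, and counting all monomials of \<open>A\<close> gives
  \<open>p F(x) + 1 / (1 - x\<^sup>p) = 1 / (1 - x)\<^sup>p\<close>. Eliminating \<open>F\<close> yields the formula.
\<close>

section \<open>Polynomials in one variable under a translation\<close>

lemma coeff_pcompose_translation:
  "coeff (pcompose P [:e, 1:]) k =
    (\<Sum>i\<le>degree P. coeff P i * (of_nat (i choose k) * e ^ (i - k)))" for P :: "'b::comm_ring_1 poly"
proof -
  have pow: "coeff ([:e, 1:] ^ i) k = of_nat (i choose k) * e ^ (i - k)" for i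
    using coeff_linear_poly_power[where a = e and b = 1 and n = i and i = k]
    by (cases "k \<le> i") (simp_all add: binomial_eq_0 coeff_eq_0 degree_linear_power)
  have "pcompose P [:e, 1:] = (\<Sum>i\<le>degree P. Polynomial.smult (coeff P i) ([:e, 1:] ^ i))"
    using poly_altdef[of "map_poly (\<lambda>x. [:x:]) P" "[:e, 1:]"]
    by (simp add: pcompose_altdef coeff_map_poly degree_map_poly)
  then show ?thesis
    by (simp add: coeff_sum pow)
qed

lemma coeff_pcompose_translation_top:
  fixes P :: "'b::comm_ring_1 poly"
  assumes "degree P \<le> k"
  shows "coeff (pcompose P [:e, 1:]) k = coeff P k"
proof -
  have "(\<Sum>i\<le>degree P. coeff P i * (of_nat (i choose k) * e ^ (i - k)))
      = (\<Sum>i\<in>{..k}. coeff P i * (of_nat (i choose k) * e ^ (i - k)))"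
    using assms by (intro sum.mono_neutral_left) (auto simp: coeff_eq_0)
  also have "\<dots> = (\<Sum>i\<in>{k}. coeff P i * (of_nat (i choose k) * e ^ (i - k)))"
    by (intro sum.mono_neutral_right) (auto simp: not_le binomial_eq_0)
  finally show ?thesis by (simp add: coeff_pcompose_translation)
qed

text \<open>Translation by \<open>e\<close> changes the coefficient just below the leading one by \<open>N e\<close> times the leading
  coefficient, where \<open>N\<close> is the degree.\<close>

lemma translation_invariant_imp_char_dvd_degree:
  fixes P :: "'b::idom poly"
  assumes "pcompose P [:e, 1:] = P" "e \<noteq> 0"
  shows "CHAR('b) dvd degree P"
proof (cases "degree P")
  case (Suc k)
  have "coeff P k = (\<Sum>i\<le>Suc k. coeff P i * (of_nat (i choose k) * e ^ (i - k)))"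
    using coeff_pcompose_translation[of P e k] assms(1) Suc by simp
  also have "\<dots> = (\<Sum>i\<in>{k, Suc k}. coeff P i * (of_nat (i choose k) * e ^ (i - k)))"
    by (intro sum.mono_neutral_right) (auto simp: not_le binomial_eq_0 le_Suc_eq)
  also have "\<dots> = coeff P k + coeff P (Suc k) * (of_nat (Suc k) * e)"
    by (simp add: binomial_Suc_n)
  finally have "coeff P (Suc k) * (of_nat (Suc k) * e) = 0" by simp
  moreover have "coeff P (Suc k) \<noteq> 0"
    using Suc by (metis degree_0 leading_coeff_0_iff nat.distinct(1))
  ultimately have "of_nat (Suc k) = (0 :: 'b)"
    using assms(2) by (simp del: of_nat_Suc)
  then show ?thesis using Suc of_nat_eq_0_iff_char_dvd by metis
qed simp

text \<open>Only the term of the binomial expansion that is linear in \<open>w\<close> reaches this degree.\<close>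

lemma coeff_power_add_const_diff:
  fixes Y :: "'b::idom poly"
  assumes "lead_coeff Y = 1" "n > 0" "degree Y > 0"
  shows "coeff ((Y + [:w:]) ^ n - Y ^ n) (degree Y * (n - 1)) = of_nat n * w"
proof -
  obtain k where n: "n = Suc k" using assms(2) gr0_conv_Suc by auto
  have Y0: "Y \<noteq> 0" using assms(1) by auto
  have summand: "coeff (of_nat (n choose i) * Y ^ i * [:w:] ^ (n - i)) (degree Y * k)
      = (if i = k then of_nat n * w else 0)" if "i \<le> k" for i
  proof -
    have eq: "of_nat (n choose i) * Y ^ i * [:w:] ^ (n - i) = Polynomial.smult (of_nat (n choose i) * w ^ (n - i)) (Y ^ i)"
      by (simp add: of_nat_poly poly_const_pow mult.commute)
    show ?thesis
    proof (cases "i = k")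
      case True
      have "coeff (Y ^ k) (degree Y * k) = 1"
        using assms(1) by (metis degree_power_eq[OF Y0] lead_coeff_power mult.commute power_one)
      then show ?thesis using True n eq by (simp add: binomial_Suc_n)
    next
      case False
      then have "degree (Y ^ i) < degree Y * k"
        using that assms(3) by (simp add: degree_power_eq[OF Y0] mult.commute)
      then show ?thesis using False eq by (simp add: coeff_eq_0)
    qed
  qed
  have "(Y + [:w:]) ^ n - Y ^ n = (\<Sum>i\<le>k. of_nat (n choose i) * Y ^ i * [:w:] ^ (n - i))"
    unfolding n by (subst binomial_ring) simp
  then have "coeff ((Y + [:w:]) ^ n - Y ^ n) (degree Y * k)
      = (\<Sum>i\<le>k. coeff (of_nat (n choose i) * Y ^ i * [:w:] ^ (n - i)) (degree Y * k))"
    by (simp only: coeff_sum)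
  also have "\<dots> = (\<Sum>i\<le>k. if i = k then of_nat n * w else 0)"
    by (intro sum.cong refl summand) simp
  finally show ?thesis by (simp add: n)
qed

section \<open>Evaluation homomorphisms\<close>

text \<open>The same as \<^const>\<open>poly_subst\<close>, but with values in an arbitrary commutative ring: the change of
  coordinates takes values in polynomials over \<^typ>\<open>'a mpoly\<close>.\<close>

definition eval_hom :: "('a::comm_ring_1 \<Rightarrow> 'b::comm_ring_1) \<Rightarrow> (nat \<Rightarrow> 'b) \<Rightarrow> 'a mpoly \<Rightarrow> 'b" where
  "eval_hom \<kappa> \<sigma> f = (\<Sum>m\<in>Poly_Mapping.keys f.
     \<kappa> (Poly_Mapping.lookup f m) * (\<Prod>i\<in>Poly_Mapping.keys m. \<sigma> i ^ Poly_Mapping.lookup m i))"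

lemma poly_subst_eq_eval_hom: "poly_subst \<sigma> = eval_hom mconst \<sigma>"
  by (simp add: fun_eq_iff eval_hom_def poly_subst_def monom_eval_def mscale_def)

lemma eval_hom_cong:
  assumes "f \<in> poly_ring n" "\<And>i. i < n \<Longrightarrow> \<sigma> i = \<tau> i"
  shows "eval_hom \<kappa> \<sigma> f = eval_hom \<kappa> \<tau> f"
  unfolding eval_hom_def
proof (intro sum.cong refl arg_cong2[where f = "(*)"] prod.cong)
  fix m i assume "m \<in> Poly_Mapping.keys f" "i \<in> Poly_Mapping.keys m"
  then have "i < n" using assms(1) by (auto simp: poly_ring_def)
  then show "\<sigma> i ^ Poly_Mapping.lookup m i = \<tau> i ^ Poly_Mapping.lookup m i"
    using assms(2) by simp
qed

lemma (in comm_ring_hom) hom_eval_hom: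
  "hom (eval_hom \<kappa> \<sigma> f) = eval_hom (\<lambda>c. hom (\<kappa> c)) (\<lambda>i. hom (\<sigma> i)) f"
  by (simp add: eval_hom_def hom_sum hom_mult hom_prod hom_power)

lemma eval_hom_single:
  assumes "comm_ring_hom \<kappa>"
  shows "eval_hom \<kappa> \<sigma> (Poly_Mapping.single m c) =
    \<kappa> c * (\<Prod>i\<in>Poly_Mapping.keys m. \<sigma> i ^ Poly_Mapping.lookup m i)"
proof -
  interpret comm_ring_hom \<kappa> by fact
  show ?thesis by (cases "c = 0") (auto simp: eval_hom_def)
qed

lemma eval_hom_add:
  assumes "comm_ring_hom \<kappa>"
  shows "eval_hom \<kappa> \<sigma> (f + g) = eval_hom \<kappa> \<sigma> f + eval_hom \<kappa> \<sigma> g"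
proof -
  interpret comm_ring_hom \<kappa> by fact
  let ?A = "Poly_Mapping.keys f \<union> Poly_Mapping.keys g"
  let ?t = "\<lambda>m. \<Prod>i\<in>Poly_Mapping.keys m. \<sigma> i ^ Poly_Mapping.lookup m i"
  have sup: "eval_hom \<kappa> \<sigma> h = (\<Sum>m\<in>?A. \<kappa> (Poly_Mapping.lookup h m) * ?t m)"
    if "Poly_Mapping.keys h \<subseteq> ?A" for h
    unfolding eval_hom_def by (rule sum.mono_neutral_left) (use that in \<open>auto simp: in_keys_iff\<close>)
  show ?thesis
    using Poly_Mapping.keys_add[of f g]
    by (simp add: sup lookup_add hom_add distrib_right sum.distrib)
qed

lemma comm_ring_hom_eval_hom:
  assumes "comm_ring_hom \<kappa>"
  shows "comm_ring_hom (eval_hom \<kappa> \<sigma>)"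
proof
  interpret comm_ring_hom \<kappa> by fact
  let ?t = "\<lambda>m. \<Prod>i\<in>Poly_Mapping.keys m. \<sigma> i ^ Poly_Mapping.lookup m i"
  show zero: "eval_hom \<kappa> \<sigma> 0 = 0" and "eval_hom \<kappa> \<sigma> 1 = 1"
    by (simp_all add: eval_hom_def)
  show add: "eval_hom \<kappa> \<sigma> (f + g) = eval_hom \<kappa> \<sigma> f + eval_hom \<kappa> \<sigma> g" for f g
    by (rule eval_hom_add[OF assms])
  have sum: "eval_hom \<kappa> \<sigma> (sum h A) = (\<Sum>i\<in>A. eval_hom \<kappa> \<sigma> (h i))" for h :: "monom \<Rightarrow> 'a mpoly" and A
    by (induction A rule: infinite_finite_induct) (auto simp: add zero)
  have t_add: "?t (a + b) = ?t a * ?t b" for a b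
  proof -
    let ?A = "Poly_Mapping.keys a \<union> Poly_Mapping.keys b"
    have sup: "?t m = (\<Prod>i\<in>?A. \<sigma> i ^ Poly_Mapping.lookup m i)" if "Poly_Mapping.keys m \<subseteq> ?A" for m
      by (rule prod.mono_neutral_left) (use that in \<open>auto simp: in_keys_iff\<close>)
    show ?thesis
      unfolding sup[of "a + b", OF Poly_Mapping.keys_add] sup[of a, OF Un_upper1] sup[of b, OF Un_upper2]
      by (simp only: lookup_add power_add prod.distrib)
  qed
  show "eval_hom \<kappa> \<sigma> (f * g) = eval_hom \<kappa> \<sigma> f * eval_hom \<kappa> \<sigma> g" for f g
  proof -
    have "f * g = (\<Sum>a\<in>Poly_Mapping.keys f. \<Sum>b\<in>Poly_Mapping.keys g.
        Poly_Mapping.single (a + b) (Poly_Mapping.lookup f a * Poly_Mapping.lookup g b))"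
      by (subst mpoly_expand[of f], subst mpoly_expand[of g]) (simp add: sum_product mult_single)
    then have "eval_hom \<kappa> \<sigma> (f * g) = (\<Sum>a\<in>Poly_Mapping.keys f. \<Sum>b\<in>Poly_Mapping.keys g.
        \<kappa> (Poly_Mapping.lookup f a * Poly_Mapping.lookup g b) * ?t (a + b))"
      by (simp only: sum eval_hom_single[OF assms])
    also have "\<dots> = eval_hom \<kappa> \<sigma> f * eval_hom \<kappa> \<sigma> g"
      by (simp add: eval_hom_def sum_product hom_mult t_add mult_ac)
    finally show ?thesis .
  qed
qed

lemma comm_ring_hom_mconst: "comm_ring_hom (mconst :: 'a::comm_ring_1 \<Rightarrow> 'a mpoly)"
  by unfold_locales (simp_all add: mconst_simps)

lemma comm_ring_hom_poly_subst: "comm_ring_hom (poly_subst \<sigma> :: 'a::comm_ring_1 mpoly \<Rightarrow> 'a mpoly)"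
  by unfold_locales (simp_all add: poly_subst_add poly_subst_mult)

lemma eval_hom_mconst:
  assumes "comm_ring_hom \<kappa>"
  shows "eval_hom \<kappa> \<sigma> (mconst c) = \<kappa> c"
  by (simp add: mconst_def eval_hom_single[OF assms])

lemma eval_hom_mvar:
  assumes "comm_ring_hom \<kappa>"
  shows "eval_hom \<kappa> \<sigma> (mvar i) = \<sigma> i"
proof -
  interpret comm_ring_hom \<kappa> by fact
  show ?thesis by (simp add: mvar_def eval_hom_single[OF assms])
qed

text \<open>The family \<open>G\<close> is meant to be the family of homogeneous components of a graded algebra.\<close>

lemma eval_hom_in_graded:
  assumes "f \<in> poly_ring n" "f \<in> homogeneous d"
    and "\<And>i. i < n \<Longrightarrow> \<sigma> i \<in> G 1"
    and const: "\<And>c. \<kappa> c \<in> G 0" and one: "1 \<in> G 0"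
    and zero: "\<And>d. 0 \<in> G d"
    and add: "\<And>d x y. x \<in> G d \<Longrightarrow> y \<in> G d \<Longrightarrow> x + y \<in> G d"
    and mult: "\<And>a b x y. x \<in> G a \<Longrightarrow> y \<in> G b \<Longrightarrow> x * y \<in> G (a + b)"
  shows "eval_hom \<kappa> \<sigma> f \<in> G d"
proof -
  have pow: "x ^ k \<in> G k" if "x \<in> G 1" for x k
  proof (induction k)
    case (Suc k)
    then show ?case using mult[OF that Suc] by simp
  qed (simp add: one)
  have prod: "(\<Prod>i\<in>A. \<sigma> i ^ e i) \<in> G (\<Sum>i\<in>A. e i)" if "finite A" "A \<subseteq> {..<n}" for A and e :: "nat \<Rightarrow> nat"
    using that
  proof (induction A rule: finite_induct)
    case (insert i A)
    then show ?case using mult[OF pow[OF assms(3)[of i]], of _ "\<Sum>i\<in>A. e i" "e i"] by simp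
  qed (simp add: one)
  have sum: "(\<Sum>i\<in>A. h i) \<in> G d" if "\<And>i. i \<in> A \<Longrightarrow> h i \<in> G d" for h and A :: "monom set"
    using that by (induction A rule: infinite_finite_induct) (auto simp: zero add)
  show ?thesis
    unfolding eval_hom_def
  proof (rule sum)
    fix m assume m: "m \<in> Poly_Mapping.keys f"
    then have "Poly_Mapping.keys m \<subseteq> {..<n}" "(\<Sum>i\<in>Poly_Mapping.keys m. Poly_Mapping.lookup m i) = d"
      using assms(1,2) by (auto simp: poly_ring_def homogeneous_def monom_degree_def)
    then show "\<kappa> (Poly_Mapping.lookup f m) *
        (\<Prod>i\<in>Poly_Mapping.keys m. \<sigma> i ^ Poly_Mapping.lookup m i) \<in> G d"
      using mult[OF const prod[of "Poly_Mapping.keys m" "Poly_Mapping.lookup m"]] by simp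
  qed
qed

section \<open>The cyclic permutation of the variables\<close>

text \<open>The permutation fixes all indices from \<open>p\<close> on, so that its \<open>p\<close>-th power is the identity
  everywhere and not only on the first \<open>p\<close> variables.\<close>

definition cyc :: "nat \<Rightarrow> nat \<Rightarrow> nat" where
  "cyc p i = (if i < p then Suc i mod p else i)"

text \<open>The action on monomials is by pullback of exponents, hence inverse to the action of
  \<open>cycle\<close>; this direction makes \<open>lookup_cycle\<close> free of inverses.\<close>

definition rot :: "nat \<Rightarrow> monom \<Rightarrow> monom" where
  "rot p = Poly_Mapping.map_key (cyc p)"

definition cycle :: "nat \<Rightarrow> 'a::comm_ring_1 mpoly \<Rightarrow> 'a mpoly" where
  "cycle p = poly_subst (\<lambda>i. mvar (cyc p i))"

lemma comm_ring_hom_cycle: "comm_ring_hom (cycle p)"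
  unfolding cycle_def by (rule comm_ring_hom_poly_subst)

lemma cyc_less: "i < p \<Longrightarrow> cyc p i < p"
  by (simp add: cyc_def)

lemma cyc_funpow: "(cyc p ^^ k) i = (if i < p then (i + k) mod p else i)"
  by (induction k) (auto simp: cyc_def mod_Suc_eq)

lemma cyc_funpow_p: "(cyc p ^^ p) = id"
  by (auto simp: cyc_funpow fun_eq_iff)

lemma inj_cyc: "inj (cyc p)"
proof (cases p)
  case 0
  then show ?thesis by (simp add: cyc_def inj_on_def)
next
  case (Suc k)
  then have "(cyc p ^^ k) \<circ> cyc p = id"
    using cyc_funpow_p[of p] by (simp only: funpow_Suc_right)
  then show ?thesis by (metis inj_on_id inj_on_imageI2)
qed

lemma cyc_image: "cyc p ` {..<p} = {..<p}"
  using cyc_less by (intro endo_inj_surj) (auto intro: inj_on_subset[OF inj_cyc])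

lemma lookup_rot: "Poly_Mapping.lookup (rot p m) i = Poly_Mapping.lookup m (cyc p i)"
  by (simp add: rot_def Poly_Mapping.map_key.rep_eq[OF inj_cyc])

lemma lookup_rot_funpow:
  "Poly_Mapping.lookup ((rot p ^^ k) m) i = Poly_Mapping.lookup m ((cyc p ^^ k) i)"
  by (induction k arbitrary: i) (simp_all add: lookup_rot funpow_swap1[of "cyc p"])

lemma rot_funpow_p: "(rot p ^^ p) m = m"
  by (rule poly_mapping_eqI) (simp add: lookup_rot_funpow cyc_funpow_p)

lemma rot_funpow_mod: "(rot p ^^ (k mod p)) m = (rot p ^^ k) m"
  by (rule poly_mapping_eqI) (simp add: lookup_rot_funpow cyc_funpow mod_add_right_eq)

lemma rot_pred: "rot p ((rot p ^^ (p - 1)) m) = m" and pred_rot: "(rot p ^^ (p - 1)) (rot p m) = m"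
proof -
  have "(rot p ^^ Suc (p - 1)) m = m"
  proof (cases "p = 0")
    case True
    then show ?thesis by (intro poly_mapping_eqI) (simp add: lookup_rot cyc_def)
  qed (simp add: rot_funpow_p del: funpow.simps)
  then show "rot p ((rot p ^^ (p - 1)) m) = m" "(rot p ^^ (p - 1)) (rot p m) = m"
    by (simp_all add: funpow_swap1)
qed

lemma inj_rot: "inj (rot p)"
  by (rule inj_on_inverseI) (rule pred_rot)

lemma keys_rot_subset:
  assumes "Poly_Mapping.keys m \<subseteq> {..<p}"
  shows "Poly_Mapping.keys (rot p m) \<subseteq> {..<p}"
proof
  fix i assume "i \<in> Poly_Mapping.keys (rot p m)"
  then have "cyc p i \<in> Poly_Mapping.keys m" by (simp add: in_keys_iff lookup_rot)
  then have "cyc p i < p" using assms by auto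
  then show "i \<in> {..<p}" by (auto simp: cyc_def split: if_splits)
qed

lemma monom_degree_superset:
  assumes "finite A" "Poly_Mapping.keys m \<subseteq> A"
  shows "monom_degree m = (\<Sum>i\<in>A. Poly_Mapping.lookup m i)"
  unfolding monom_degree_def
  by (rule sum.mono_neutral_left) (use assms in \<open>auto simp: in_keys_iff\<close>)

lemma monom_degree_add: "monom_degree (a + b) = monom_degree a + monom_degree b"
proof -
  let ?A = "Poly_Mapping.keys a \<union> Poly_Mapping.keys b"
  have "monom_degree (a + b) = (\<Sum>i\<in>?A. Poly_Mapping.lookup (a + b) i)"
    by (intro monom_degree_superset Poly_Mapping.keys_add) auto
  also have "\<dots> = (\<Sum>i\<in>?A. Poly_Mapping.lookup a i) + (\<Sum>i\<in>?A. Poly_Mapping.lookup b i)"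
    by (simp only: lookup_add sum.distrib)
  also have "\<dots> = monom_degree a + monom_degree b"
    by (subst (1 2) monom_degree_superset[of ?A]) auto
  finally show ?thesis .
qed

lemma monom_degree_rot:
  assumes "Poly_Mapping.keys m \<subseteq> {..<p}"
  shows "monom_degree (rot p m) = monom_degree m"
proof -
  have "monom_degree (rot p m) = (\<Sum>i<p. Poly_Mapping.lookup m (cyc p i))"
    using keys_rot_subset[OF assms] by (simp add: monom_degree_superset[of "{..<p}"] lookup_rot)
  also have "\<dots> = (\<Sum>i\<in>cyc p ` {..<p}. Poly_Mapping.lookup m i)"
    by (simp add: sum.reindex inj_on_subset[OF inj_cyc])
  also have "\<dots> = monom_degree m"
    using assms by (simp add: cyc_image monom_degree_superset[of "{..<p}"])
  finally show ?thesis .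
qed

lemma rot_funpow_closed:
  assumes "Poly_Mapping.keys m \<subseteq> {..<p}"
  shows "Poly_Mapping.keys ((rot p ^^ k) m) \<subseteq> {..<p} \<and> monom_degree ((rot p ^^ k) m) = monom_degree m"
  by (induction k) (use assms in \<open>auto simp: keys_rot_subset monom_degree_rot\<close>)

text \<open>Both sides are additive, so a single monomial is enough; substituting permuted variables into it
  amounts to relabelling the factors of the product.\<close>

lemma lookup_cycle: "Poly_Mapping.lookup (cycle p f) m = Poly_Mapping.lookup f (rot p m)"
proof -
  have single: "cycle p (Poly_Mapping.single n c) = Poly_Mapping.map_key (rot p) (Poly_Mapping.single n c)"
    for n and c :: 'a
  proof -
    obtain m where n: "n = rot p m"
      using rot_pred[of p n] by metis
    have keys: "Poly_Mapping.keys m = cyc p ` Poly_Mapping.keys n"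
    proof -
      have "cyc p ` (cyc p -` Poly_Mapping.keys m) = Poly_Mapping.keys m"
      proof (rule surj_image_vimage_eq)
        have "j \<in> range (cyc p)" for j
          using cyc_image[of p] by (cases "j < p") (auto simp: cyc_def intro: rev_image_eqI[of j])
        then show "surj (cyc p)" by auto
      qed
      then show ?thesis
        by (simp add: n rot_def keys_map_key[OF inj_cyc])
    qed
    have "monom_eval (\<lambda>i. mvar (cyc p i) :: 'a mpoly) n
        = (\<Prod>i\<in>Poly_Mapping.keys n. mvar (cyc p i) ^ Poly_Mapping.lookup m (cyc p i))"
      by (simp add: monom_eval_def n lookup_rot)
    also have "\<dots> = monom_eval mvar m"
      unfolding monom_eval_def keys
      by (subst prod.reindex) (auto intro: inj_on_subset[OF inj_cyc])
    finally have ev: "monom_eval (\<lambda>i. mvar (cyc p i) :: 'a mpoly) n = monom_eval mvar m" .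
    have "cycle p (Poly_Mapping.single n c) = mscale c (monom_eval mvar m)"
      by (simp add: cycle_def poly_subst_single ev)
    also have "\<dots> = poly_subst mvar (Poly_Mapping.single m c)"
      by (simp add: poly_subst_single)
    also have "\<dots> = Poly_Mapping.map_key (rot p) (Poly_Mapping.single n c)"
      by (simp add: poly_subst_id n Poly_Mapping.map_key_single[OF inj_rot])
    finally show ?thesis .
  qed
  interpret comm_ring_hom "cycle p :: 'a mpoly \<Rightarrow> 'a mpoly" by (rule comm_ring_hom_cycle)
  have map_key_sum: "Poly_Mapping.map_key (rot p) (sum h A) = (\<Sum>i\<in>A. Poly_Mapping.map_key (rot p) (h i))"
    for h :: "monom \<Rightarrow> 'a mpoly" and A
    by (induction A rule: infinite_finite_induct)
      (auto simp: Poly_Mapping.map_key_plus[OF inj_rot] Poly_Mapping.map_key_zero[OF inj_rot])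
  have "cycle p f = Poly_Mapping.map_key (rot p) f"
    by (subst (1 2) mpoly_expand[of f]) (simp only: hom_sum single map_key_sum)
  then show ?thesis by (simp add: Poly_Mapping.map_key.rep_eq[OF inj_rot])
qed

lemma lookup_cycle_funpow:
  "Poly_Mapping.lookup ((cycle p ^^ k) f) m = Poly_Mapping.lookup f ((rot p ^^ k) m)"
  by (induction k arbitrary: m) (simp_all add: lookup_cycle funpow_swap1[of "rot p"])

lemma cycle_funpow_p: "(cycle p ^^ p) f = f"
  by (rule poly_mapping_eqI) (simp add: lookup_cycle_funpow rot_funpow_p)

lemma cycle_mvar: "cycle p (mvar i) = mvar (cyc p i)"
  by (simp add: cycle_def poly_subst_mvar)

lemma cycle_funpow_mvar: "i < p \<Longrightarrow> (cycle p ^^ k) (mvar i) = mvar ((i + k) mod p)"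
proof (induction k)
  case (Suc k)
  then show ?case by (simp add: cycle_mvar cyc_def mod_Suc_eq)
qed simp

section \<open>Orbits of monomials\<close>

definition const_monom :: "nat \<Rightarrow> nat \<Rightarrow> monom" where
  "const_monom p k = (\<Sum>i<p. Poly_Mapping.single i k)"

lemma lookup_const_monom: "Poly_Mapping.lookup (const_monom p k) i = (if i < p then k else 0)"
proof -
  have "Poly_Mapping.lookup (const_monom p k) i = (\<Sum>j<p. if j = i then k else 0)"
    by (simp add: const_monom_def lookup_sum lookup_single when_def)
  then show ?thesis by simp
qed

lemma const_monom_add: "const_monom p (k + l) = const_monom p k + const_monom p l"
  by (rule poly_mapping_eqI) (simp add: lookup_const_monom lookup_add)

lemma keys_const_monom: "Poly_Mapping.keys (const_monom p k) \<subseteq> {..<p}"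
  by (auto simp: in_keys_iff lookup_const_monom split: if_splits)

lemma monom_degree_const_monom: "monom_degree (const_monom p k) = p * k"
  using monom_degree_superset[OF _ keys_const_monom, of p k] by (simp add: lookup_const_monom)

lemma rot_fixed_iff:
  assumes "Poly_Mapping.keys m \<subseteq> {..<p}"
  shows "rot p m = m \<longleftrightarrow> (\<exists>k. m = const_monom p k)"
proof
  assume fixed: "rot p m = m"
  have iter: "(rot p ^^ i) m = m" for i
    by (induction i) (simp_all add: fixed)
  have const: "Poly_Mapping.lookup m i = Poly_Mapping.lookup m 0" if "i < p" for i
    using lookup_rot_funpow[where p = p and k = i and m = m and i = 0] iter[of i] that by (simp add: cyc_funpow)
  have "Poly_Mapping.lookup m i = Poly_Mapping.lookup (const_monom p (Poly_Mapping.lookup m 0)) i" for i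
  proof (cases "i < p")
    case True
    then show ?thesis by (simp add: lookup_const_monom const[OF True])
  next
    case False
    then have "i \<notin> Poly_Mapping.keys m" using assms by auto
    then show ?thesis using False by (simp add: lookup_const_monom in_keys_iff)
  qed
  then show "\<exists>k. m = const_monom p k" using poly_mapping_eqI by blast
next
  assume "\<exists>k. m = const_monom p k"
  then show "rot p m = m"
    by (auto intro!: poly_mapping_eqI simp: lookup_rot cyc_def lookup_const_monom)
qed

text \<open>An orbit of length \<open>1 < l < p\<close> is impossible because \<open>p\<close> is prime.\<close>

lemma rot_funpow_fixed_imp_dvd:
  assumes "prime p" "rot p m \<noteq> m" "(rot p ^^ k) m = m"
  shows "p dvd k"
proof (rule ccontr)
  assume "\<not> p dvd k"
  then have "coprime k p" using assms(1) prime_imp_coprime coprime_commute by blast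
  moreover have "k \<noteq> 0" using \<open>\<not> p dvd k\<close> dvd_0_right by metis
  ultimately obtain x y where xy: "k * x = p * y + 1"
    using bezout_nat[of k p] by (metis coprime_imp_gcd_eq_1)
  have it: "(rot p ^^ (a * j)) m = m" if "(rot p ^^ a) m = m" for a j
    by (induction j) (simp_all add: funpow_add that)
  have "(rot p ^^ (k * x)) m = rot p m"
    unfolding xy using it[OF rot_funpow_p] by (simp add: funpow_add)
  then show False using it[OF assms(3), of x] assms(2) by simp
qed

text \<open>A transversal for the orbits of length greater than one: the least element of each such orbit, in
  the linear order of exponent vectors.\<close>

definition orbit_min :: "nat \<Rightarrow> monom \<Rightarrow> bool" where
  "orbit_min p m \<longleftrightarrow> rot p m \<noteq> m \<and> (\<forall>k. m \<le> (rot p ^^ k) m)"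

lemma orbit_min_unique:
  assumes "orbit_min p m" "orbit_min p m'" "(rot p ^^ k) m = m'" "p > 0"
  shows "m = m'"
proof (rule antisym)
  show "m \<le> m'" using assms(1,3) by (auto simp: orbit_min_def)
  have "k + (p - k mod p) = (k div p) * p + p"
    using assms(4) by (metis add.assoc add_diff_inverse_nat div_mult_mod_eq mod_less_divisor not_less_iff_gr_or_eq)
  then have "(k + (p - k mod p)) mod p = 0" by simp
  then have "(rot p ^^ (k + (p - k mod p))) m = m"
    using rot_funpow_mod[where p = p and k = "k + (p - k mod p)" and m = m] by simp
  then have "(rot p ^^ (p - k mod p)) m' = m"
    using assms(3) by (metis add.commute comp_apply funpow_add)
  then show "m' \<le> m" using assms(2) by (metis orbit_min_def)
qed

lemma orbit_min_exists:
  assumes "rot p m \<noteq> m" "p > 0"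
  obtains k m' where "orbit_min p m'" "k < p" "m = (rot p ^^ k) m'"
proof -
  let ?O = "(\<lambda>k. (rot p ^^ k) m) ` {..<p}"
  define m' where "m' = Min ?O"
  have "?O \<noteq> {}" "finite ?O" using assms(2) by auto
  then have "m' \<in> ?O" and le: "m' \<le> x" if "x \<in> ?O" for x
    using that by (auto simp: m'_def)
  then obtain j where j: "j < p" "m' = (rot p ^^ j) m"
    using \<open>?O \<noteq> {}\<close> by fastforce
  have all: "(rot p ^^ k) m \<in> ?O" for k
    using assms(2) rot_funpow_mod[of k p m] by (auto intro!: rev_image_eqI[of "k mod p"])
  have back_to_m: "m = (rot p ^^ ((p - j) mod p)) m'"
  proof -
    have "(rot p ^^ (p - j)) m' = (rot p ^^ (p - j + j)) m"
      by (simp only: j(2) funpow_add comp_apply)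
    then show ?thesis using j(1) by (simp add: rot_funpow_mod rot_funpow_p)
  qed
  have "rot p m' \<noteq> m'"
  proof
    assume fixed: "rot p m' = m'"
    have "(rot p ^^ i) m' = m'" for i by (induction i) (simp_all add: fixed)
    then show False using back_to_m fixed assms(1) by metis
  qed
  moreover have "m' \<le> (rot p ^^ k) m'" for k
  proof -
    have "(rot p ^^ k) m' = (rot p ^^ (k + j)) m" by (simp add: j(2) funpow_add)
    then show ?thesis using le[OF all] by metis
  qed
  ultimately have "orbit_min p m'" by (simp add: orbit_min_def)
  then show thesis using back_to_m assms(2) by (intro that[of m' "(p - j) mod p"]) auto
qed

definition monomials :: "nat \<Rightarrow> nat \<Rightarrow> monom set" where
  "monomials n e = {m. Poly_Mapping.keys m \<subseteq> {..<n} \<and> monom_degree m = e}"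

text \<open>Rotating the least elements of the orbits by \<open>0, \<dots>, p - 1\<close> reaches every monomial that is not
  fixed exactly once.\<close>

lemma card_nonfixed_monomials:
  assumes "prime p"
  shows "card {m \<in> monomials p e. rot p m \<noteq> m} = p * card {m \<in> monomials p e. orbit_min p m}"
    (is "card ?T = p * card ?C")
proof -
  have p: "p > 0" using assms by (rule prime_gt_0_nat)
  let ?f = "\<lambda>(k, m). (rot p ^^ k) m"
  have "bij_betw ?f ({..<p} \<times> ?C) ?T"
  proof (rule bij_betw_imageI)
    show "inj_on ?f ({..<p} \<times> ?C)"
    proof (rule inj_onI, clarify)
      fix k m j m'
      assume k: "k < p" and j: "j < p" and m: "orbit_min p m" and m': "orbit_min p m'"
        and eq: "(rot p ^^ k) m = (rot p ^^ j) m'"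
      have "(rot p ^^ ((p - j) + k)) m = (rot p ^^ ((p - j) + j)) m'"
        by (simp only: funpow_add comp_apply eq)
      then have *: "(rot p ^^ ((p - j) + k)) m = m'"
        using j by (simp add: rot_funpow_p)
      then have mm: "m = m'" using orbit_min_unique[OF m m' _ p] by blast
      have "p dvd (p - j) + k"
        using rot_funpow_fixed_imp_dvd[OF assms, of m] * mm m by (simp add: orbit_min_def)
      then obtain c where c: "(p - j) + k = p * c" by (rule dvdE)
      have "0 < p * c" "p * c < p * 2" using j k c by linarith+
      then have "c = 1" by simp
      then have "k = j" using j k c by simp
      then show "k = j \<and> m = m'" using mm by simp
    qed
    show "?f ` ({..<p} \<times> ?C) = ?T"
    proof
      show "?f ` ({..<p} \<times> ?C) \<subseteq> ?T"
      proof clarify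
        fix k m assume mono: "m \<in> monomials p e" and m: "orbit_min p m"
        have "rot p ((rot p ^^ k) m) \<noteq> (rot p ^^ k) m"
        proof
          assume "rot p ((rot p ^^ k) m) = (rot p ^^ k) m"
          then have "(rot p ^^ k) (rot p m) = (rot p ^^ k) m" by (simp add: funpow_swap1)
          moreover have "inj (rot p ^^ k)" by (rule inj_fn[OF inj_rot])
          ultimately show False using m by (auto simp: orbit_min_def dest: injD)
        qed
        moreover have "(rot p ^^ k) m \<in> monomials p e"
          using rot_funpow_closed[of m p k] mono by (simp add: monomials_def)
        ultimately show "(rot p ^^ k) m \<in> monomials p e \<and> rot p ((rot p ^^ k) m) \<noteq> (rot p ^^ k) m"
          by simp
      qed
      show "?T \<subseteq> ?f ` ({..<p} \<times> ?C)"
      proof clarify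
        fix m assume m: "m \<in> monomials p e" "rot p m \<noteq> m"
        obtain k m' where km: "orbit_min p m'" "k < p" "m = (rot p ^^ k) m'"
          using orbit_min_exists[OF m(2) p] .
        have "m' = (rot p ^^ (p - k)) m"
        proof -
          have "(rot p ^^ (p - k)) m = (rot p ^^ (p - k + k)) m'"
            by (simp only: km(3) funpow_add comp_apply)
          then show ?thesis using km(2) by (simp add: rot_funpow_p)
        qed
        then have "m' \<in> ?C"
          using rot_funpow_closed[of m p "p - k"] m(1) km(1) by (simp add: monomials_def)
        then show "m \<in> ?f ` ({..<p} \<times> ?C)"
          using km by (intro image_eqI[of _ _ "(k, m')"]) auto
      qed
    qed
  qed
  then have "card ({..<p} \<times> ?C) = card ?T" by (rule bij_betw_same_card)
  then show ?thesis by (simp add: card_cartesian_product)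
qed

section \<open>Graded pieces\<close>

definition hpoly :: "nat \<Rightarrow> nat \<Rightarrow> 'a::zero mpoly set" where
  "hpoly n d = poly_ring n \<inter> homogeneous d"

lemma hpolyD:
  assumes "f \<in> hpoly n d" "m \<in> Poly_Mapping.keys f"
  shows "Poly_Mapping.keys m \<subseteq> {..<n}" "monom_degree m = d"
  using assms by (auto simp: hpoly_def poly_ring_def homogeneous_def)

lemma hpolyI:
  assumes "\<And>m. m \<in> Poly_Mapping.keys f \<Longrightarrow> Poly_Mapping.keys m \<subseteq> {..<n} \<and> monom_degree m = d"
  shows "f \<in> hpoly n d"
  using assms by (auto simp: hpoly_def poly_ring_def homogeneous_def)

lemma hpoly_zero [simp]: "0 \<in> hpoly n d"
  by (rule hpolyI) simp

lemma hpoly_add: "f \<in> hpoly n d \<Longrightarrow> g \<in> hpoly n d \<Longrightarrow> f + g \<in> hpoly n d"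
  using Poly_Mapping.keys_add[of f g] by (intro hpolyI) (blast dest: hpolyD)

lemma hpoly_sum: "(\<And>i. i \<in> A \<Longrightarrow> f i \<in> hpoly n d) \<Longrightarrow> sum f A \<in> hpoly n d"
  by (induction A rule: infinite_finite_induct) (auto intro: hpoly_add)

lemma hpoly_uminus: "f \<in> hpoly n d \<Longrightarrow> - f \<in> hpoly n d" for f :: "'a::ab_group_add mpoly"
  by (rule hpolyI) (auto simp: dest: hpolyD)

lemma hpoly_mult:
  assumes "f \<in> hpoly n a" "g \<in> hpoly n b"
  shows "f * g \<in> hpoly n (a + b)"
proof (rule hpolyI)
  fix m assume "m \<in> Poly_Mapping.keys (f * g)"
  then obtain k l where m: "m = k + l" "k \<in> Poly_Mapping.keys f" "l \<in> Poly_Mapping.keys g"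
    using Poly_Mapping.keys_mult[of f g] by blast
  show "Poly_Mapping.keys m \<subseteq> {..<n} \<and> monom_degree m = a + b"
    using hpolyD[OF assms(1) m(2)] hpolyD[OF assms(2) m(3)] Poly_Mapping.keys_add[of k l]
    by (auto simp: m(1) monom_degree_add)
qed

lemma hpoly_single:
  "Poly_Mapping.keys m \<subseteq> {..<n} \<Longrightarrow> Poly_Mapping.single m c \<in> hpoly n (monom_degree m)"
  by (rule hpolyI) (auto split: if_splits)

lemma hpoly_mconst: "mconst c \<in> hpoly n 0"
  using hpoly_single[of 0 n c] by (simp add: mconst_def monom_degree_def)

lemma hpoly_one [simp]: "(1 :: 'a::comm_semiring_1 mpoly) \<in> hpoly n 0"
  using hpoly_mconst[of "1 :: 'a" n] by (simp add: mconst_simps)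

lemma hpoly_mvar: "i < n \<Longrightarrow> mvar i \<in> hpoly n 1"
  using hpoly_single[of "Poly_Mapping.single i 1" n 1] by (simp add: mvar_def monom_degree_def)

lemma hpoly_power: "f \<in> hpoly n d \<Longrightarrow> f ^ k \<in> hpoly n (k * d)" for f :: "'a::comm_semiring_1 mpoly"
  by (induction k) (auto intro: hpoly_mult)

lemma hpoly_of_nat_mult: "f \<in> hpoly n d \<Longrightarrow> of_nat k * f \<in> hpoly n d" for f :: "'a::comm_semiring_1 mpoly"
  by (induction k) (auto simp: distrib_right intro: hpoly_add)

lemma poly_subst_in_hpoly:
  fixes f :: "'a::comm_ring_1 mpoly"
  assumes "f \<in> hpoly n d" "\<And>i. i < n \<Longrightarrow> \<sigma> i \<in> hpoly k 1"
  shows "poly_subst \<sigma> f \<in> hpoly k d"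
  unfolding poly_subst_eq_eval_hom using assms
  by (intro eval_hom_in_graded[where n = n])
    (auto simp: hpoly_def[of n] intro: hpoly_mconst hpoly_add hpoly_mult)

lemma cycle_in_hpoly: "f \<in> hpoly p d \<Longrightarrow> cycle p f \<in> hpoly p d"
  unfolding cycle_def by (rule poly_subst_in_hpoly) (assumption, rule hpoly_mvar, erule cyc_less)

text \<open>The homogeneous component of total degree \<open>d\<close> of \<open>A[X]\<close>, with \<open>X\<close> of degree one.\<close>

definition gpoly :: "nat \<Rightarrow> nat \<Rightarrow> 'a::zero mpoly poly set" where
  "gpoly n d = {P. degree P \<le> d \<and> (\<forall>k\<le>d. coeff P k \<in> hpoly n (d - k))}"

lemma gpoly_zero [simp]: "0 \<in> gpoly n d"
  by (simp add: gpoly_def)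

lemma gpoly_add: "P \<in> gpoly n d \<Longrightarrow> Q \<in> gpoly n d \<Longrightarrow> P + Q \<in> gpoly n d"
  by (auto simp: gpoly_def intro: hpoly_add degree_add_le)

lemma gpoly_uminus: "P \<in> gpoly n d \<Longrightarrow> - P \<in> gpoly n d" for P :: "'a::ab_group_add mpoly poly"
  by (auto simp: gpoly_def intro: hpoly_uminus)

lemma gpoly_sum: "(\<And>i. i \<in> A \<Longrightarrow> f i \<in> gpoly n d) \<Longrightarrow> sum f A \<in> gpoly n d"
  by (induction A rule: infinite_finite_induct) (auto intro: gpoly_add)

lemma gpoly_mult:
  assumes P: "P \<in> gpoly n a" and Q: "Q \<in> gpoly n b"
  shows "P * Q \<in> gpoly n (a + b)"
proof -
  have "degree (P * Q) \<le> a + b"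
    using assms degree_mult_le[of P Q] by (auto simp: gpoly_def)
  moreover have "coeff (P * Q) k \<in> hpoly n (a + b - k)" for k
    unfolding coeff_mult
  proof (rule hpoly_sum)
    fix i assume i: "i \<in> {..k}"
    show "coeff P i * coeff Q (k - i) \<in> hpoly n (a + b - k)"
    proof (cases "i \<le> a \<and> k - i \<le> b")
      case True
      then have "coeff P i * coeff Q (k - i) \<in> hpoly n ((a - i) + (b - (k - i)))"
        using P Q by (intro hpoly_mult) (auto simp: gpoly_def)
      moreover have "(a - i) + (b - (k - i)) = a + b - k" using True i by auto
      ultimately show ?thesis by simp
    next
      case False
      then have "coeff P i = 0 \<or> coeff Q (k - i) = 0"
        using P Q by (auto simp: gpoly_def intro: coeff_eq_0)
      then show ?thesis by auto
    qed
  qed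
  ultimately show ?thesis by (simp add: gpoly_def)
qed

lemma gpoly_monom:
  assumes "c \<in> hpoly n d"
  shows "Polynomial.monom c k \<in> gpoly n (d + k)"
  using assms degree_monom_le[of c k] by (auto simp: gpoly_def coeff_monom)

lemma gpoly_const: "c \<in> hpoly n d \<Longrightarrow> [:c:] \<in> gpoly n d"
  using gpoly_monom[of c n d 0] by (simp add: monom_0)

lemma gpoly_one [simp]: "1 \<in> gpoly n 0"
  using gpoly_const[OF hpoly_one] by (simp add: one_pCons)

lemma gpoly_X: "([:0, 1:] :: 'a::comm_semiring_1 mpoly poly) \<in> gpoly n 1"
  using gpoly_monom[OF hpoly_one, where n = n and k = 1] by (simp add: monom_altdef)

lemma gpoly_power: "P \<in> gpoly n d \<Longrightarrow> P ^ k \<in> gpoly n (k * d)" for P :: "'a::comm_semiring_1 mpoly poly"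
  by (induction k) (auto intro: gpoly_mult)

lemma gpoly_prod:
  fixes f :: "'i \<Rightarrow> 'a::comm_semiring_1 mpoly poly"
  shows "finite A \<Longrightarrow> (\<And>i. i \<in> A \<Longrightarrow> f i \<in> gpoly n d) \<Longrightarrow> prod f A \<in> gpoly n (card A * d)"
  by (induction A rule: finite_induct) (auto intro: gpoly_mult)

section \<open>Coefficients of products\<close>

lemma lookup_mvar: "Poly_Mapping.lookup (mvar i) m = (if m = Poly_Mapping.single i 1 then 1 else 0)"
  by (auto simp: mvar_def lookup_single when_def)

lemma lookup_single_mult:
  "Poly_Mapping.lookup (Poly_Mapping.single m c * g) (m + n) = c * Poly_Mapping.lookup g n"
  for g :: "'a::comm_ring_1 mpoly"
proof -
  have "Poly_Mapping.single m c * g = (\<Sum>k\<in>Poly_Mapping.keys g. Poly_Mapping.single (m + k) (c * Poly_Mapping.lookup g k))"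
    by (subst (1) mpoly_expand[of g]) (simp add: sum_distrib_left mult_single)
  then have "Poly_Mapping.lookup (Poly_Mapping.single m c * g) (m + n)
      = (\<Sum>k\<in>Poly_Mapping.keys g. if k = n then c * Poly_Mapping.lookup g k else 0)"
    by (simp add: lookup_sum lookup_single when_def)
  then show ?thesis by (auto simp: in_keys_iff)
qed

lemma lookup_mvar_mult:
  "Poly_Mapping.lookup (mvar i * g) m =
    (if i \<in> Poly_Mapping.keys m then Poly_Mapping.lookup g (m - Poly_Mapping.single i 1) else 0)"
  for g :: "'a::comm_ring_1 mpoly"
proof (cases "i \<in> Poly_Mapping.keys m")
  case True
  then have m: "m = Poly_Mapping.single i 1 + (m - Poly_Mapping.single i 1)"
    by (intro poly_mapping_eqI) (auto simp: lookup_add lookup_minus lookup_single when_def in_keys_iff)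
  show ?thesis
    using True by (subst m) (simp add: mvar_def lookup_single_mult del: add_diff_cancel_left')
next
  case False
  have "m \<notin> Poly_Mapping.keys (mvar i * g)"
  proof
    assume "m \<in> Poly_Mapping.keys (mvar i * g)"
    then obtain k l where "m = k + l" "k \<in> Poly_Mapping.keys (mvar i :: 'a mpoly)"
      using Poly_Mapping.keys_mult[of "mvar i" g] by blast
    then show False using False by (auto simp: mvar_def lookup_add in_keys_iff split: if_splits)
  qed
  then show ?thesis using False by (simp add: in_keys_iff)
qed

text \<open>The multinomial coefficient of a squarefree monomial of degree \<open>k\<close> in a \<open>k\<close>-th power of a sum
  of variables: the monomial arises once from each ordering of its variables.\<close>

lemma lookup_sum_mvar_power:
  assumes "finite I" "J \<subseteq> I"
  shows "Poly_Mapping.lookup ((\<Sum>i\<in>I. mvar i) ^ card J) (\<Sum>j\<in>J. Poly_Mapping.single j 1)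
    = (of_nat (fact (card J)) :: 'a::comm_ring_1)"
  using assms(2)
proof (induction "card J" arbitrary: J)
  case 0
  then have "J = {}" using assms(1) finite_subset by fastforce
  then show ?case by (simp add: lookup_one)
next
  case (Suc n)
  let ?e = "\<Sum>i\<in>I. mvar i :: 'a mpoly" and ?m = "\<lambda>J. \<Sum>j\<in>J. Poly_Mapping.single j (1::nat)"
  have J: "finite J" using Suc.prems assms(1) finite_subset by blast
  have look: "Poly_Mapping.lookup (?m J) i = (if i \<in> J then 1 else 0)" for i
    using J by (simp add: lookup_sum lookup_single when_def)
  have keys: "i \<in> Poly_Mapping.keys (?m J) \<longleftrightarrow> i \<in> J" for i
    by (simp only: in_keys_iff look) simp
  have "Poly_Mapping.lookup (?e ^ Suc n) (?m J) = (\<Sum>i\<in>I. Poly_Mapping.lookup (mvar i * ?e ^ n) (?m J))"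
    by (simp add: sum_distrib_right lookup_sum)
  also have "\<dots> = (\<Sum>i\<in>I. if i \<in> J then Poly_Mapping.lookup (?e ^ n) (?m J - Poly_Mapping.single i 1) else 0)"
    by (simp only: lookup_mvar_mult keys)
  also have "\<dots> = (\<Sum>i\<in>J. Poly_Mapping.lookup (?e ^ n) (?m J - Poly_Mapping.single i 1))"
    using assms(1) Suc.prems by (intro sum.mono_neutral_cong_right) auto
  also have "\<dots> = (\<Sum>i\<in>J. of_nat (fact n))"
  proof (rule sum.cong)
    fix i assume i: "i \<in> J"
    have "?m J - Poly_Mapping.single i 1 = ?m (J - {i})"
      using J i by (simp add: sum.remove[of J i])
    moreover have "n = card (J - {i})" using Suc.hyps(2) i J by simp
    ultimately show "Poly_Mapping.lookup (?e ^ n) (?m J - Poly_Mapping.single i 1) = of_nat (fact n)"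
      using Suc.hyps(1)[of "J - {i}"] Suc.prems by auto
  qed simp
  finally show ?case by (simp add: Suc.hyps(2)[symmetric] algebra_simps)
qed

section \<open>The generator in straightened coordinates\<close>

lemma comm_ring_hom_comp:
  assumes "comm_ring_hom f" "comm_ring_hom g"
  shows "comm_ring_hom (\<lambda>x. f (g x))"
proof -
  interpret f: comm_ring_hom f by fact
  interpret g: comm_ring_hom g by fact
  show ?thesis
    by unfold_locales (simp_all add: f.hom_add g.hom_add f.hom_mult g.hom_mult)
qed

lemma comm_ring_hom_funpow:
  fixes f :: "'b::comm_ring_1 \<Rightarrow> 'b"
  assumes "comm_ring_hom f"
  shows "comm_ring_hom (f ^^ k)"
proof (induction k)
  case 0
  have "f ^^ 0 = (\<lambda>x. x)" by auto
  then show ?case by unfold_locales simp_all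
next
  case (Suc k)
  then show ?case using comm_ring_hom_comp[OF assms Suc] by (simp add: comp_def)
qed

lemma comm_ring_hom_map_poly:
  assumes "comm_ring_hom f"
  shows "comm_ring_hom (map_poly f)"
proof -
  interpret comm_ring_hom f by fact
  interpret h: map_poly_comm_ring_hom f ..
  show ?thesis by unfold_locales
qed

lemma comm_ring_hom_pcompose: "comm_ring_hom (\<lambda>P. pcompose P Q)"
  by unfold_locales (simp_all add: pcompose_add pcompose_mult)

text \<open>The generator in the coordinates \<open>z\<^sub>0, \<dots>, z\<^sub>p\<^sub>-\<^sub>1, X\<close>: it permutes the variables of the
  coefficients and translates \<open>X\<close> by \<open>z\<^sub>0\<close>.\<close>

definition shear :: "nat \<Rightarrow> 'a::field mpoly poly \<Rightarrow> 'a mpoly poly" where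
  "shear p P = pcompose (map_poly (cycle p) P) [:mvar 0, 1:]"

lemma comm_ring_hom_shear: "comm_ring_hom (shear p)"
  unfolding shear_def
  by (rule comm_ring_hom_comp[OF comm_ring_hom_pcompose comm_ring_hom_map_poly[OF comm_ring_hom_cycle]])

lemma coeff_shear:
  "coeff (shear p P) k = (\<Sum>i\<le>degree P. cycle p (coeff P i) * (of_nat (i choose k) * mvar 0 ^ (i - k)))"
proof -
  interpret comm_ring_hom "cycle p" by (rule comm_ring_hom_cycle)
  let ?Q = "map_poly (cycle p) P"
  have "(\<Sum>i\<le>degree ?Q. coeff ?Q i * (of_nat (i choose k) * mvar 0 ^ (i - k)))
      = (\<Sum>i\<le>degree P. coeff ?Q i * (of_nat (i choose k) * mvar 0 ^ (i - k)))"
    by (rule sum.mono_neutral_left) (auto simp: coeff_eq_0 simp del: coeff_map_poly_hom intro: order_trans[OF _ degree_map_poly_le])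
  then show ?thesis
    by (simp add: shear_def coeff_pcompose_translation)
qed

text \<open>A translation does not affect the leading coefficient, so there only the permutation is visible.
  The inequality makes the rule usable without knowing the exact degree.\<close>

lemma coeff_shear_top:
  assumes "degree P \<le> k"
  shows "coeff (shear p P) k = cycle p (coeff P k)"
proof -
  interpret comm_ring_hom "cycle p" by (rule comm_ring_hom_cycle)
  have "degree (map_poly (cycle p) P) \<le> k" using degree_map_poly_le assms by (rule order_trans)
  then show ?thesis by (simp add: shear_def coeff_pcompose_translation_top)
qed

lemma shear_const: "shear p [:c:] = [:cycle p c:]"
proof -
  interpret comm_ring_hom "cycle p" by (rule comm_ring_hom_cycle)
  show ?thesis by (simp add: shear_def map_poly_pCons_hom)
qed

lemma shear_X: "shear p [:0, 1:] = [:mvar 0, 1:]"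
proof -
  interpret comm_ring_hom "cycle p" by (rule comm_ring_hom_cycle)
  show ?thesis by (simp add: shear_def map_poly_pCons_hom)
qed

lemma shear_in_gpoly:
  assumes P: "P \<in> gpoly p d" and "p > 0"
  shows "shear p P \<in> gpoly p d"
proof -
  have coeffs: "coeff (shear p P) k \<in> hpoly p (d - k)" if "k \<le> d" for k
    unfolding coeff_shear
  proof (rule hpoly_sum)
    fix i assume "i \<in> {..degree P}"
    then have i: "i \<le> d" using P by (auto simp: gpoly_def)
    show "cycle p (coeff P i) * (of_nat (i choose k) * mvar 0 ^ (i - k)) \<in> hpoly p (d - k)"
    proof (cases "k \<le> i")
      case True
      have "cycle p (coeff P i) \<in> hpoly p (d - i)"
        using P i by (intro cycle_in_hpoly) (simp add: gpoly_def)
      moreover have "of_nat (i choose k) * (mvar 0 :: 'a mpoly) ^ (i - k) \<in> hpoly p ((i - k) * 1)"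
        by (rule hpoly_of_nat_mult, rule hpoly_power, rule hpoly_mvar, rule assms)
      ultimately have "cycle p (coeff P i) * (of_nat (i choose k) * mvar 0 ^ (i - k)) \<in> hpoly p ((d - i) + (i - k) * 1)"
        by (rule hpoly_mult)
      then show ?thesis using True i by simp
    qed (simp add: binomial_eq_0)
  qed
  have "degree (shear p P) \<le> d"
  proof (rule degree_le, intro allI impI)
    fix k assume k: "d < k"
    interpret comm_ring_hom "cycle p :: 'a mpoly \<Rightarrow> _" by (rule comm_ring_hom_cycle)
    have "degree P < k" using P k by (auto simp: gpoly_def)
    then show "coeff (shear p P) k = 0"
      by (simp add: coeff_shear_top coeff_eq_0)
  qed
  then show ?thesis using coeffs by (simp add: gpoly_def)
qed

lemma shear_funpow_in_gpoly: "P \<in> gpoly p d \<Longrightarrow> p > 0 \<Longrightarrow> (shear p ^^ k) P \<in> gpoly p d"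
  by (induction k) (auto intro: shear_in_gpoly)

text \<open>The translations accumulate as the partial sums of the orbit of \<open>z\<^sub>0\<close>.\<close>

lemma shear_funpow:
  "(shear p ^^ k) P = pcompose (map_poly (cycle p ^^ k) P) [:\<Sum>j<k. (cycle p ^^ j) (mvar 0), 1:]"
proof (induction k)
  case 0
  show ?case by (simp add: pcompose_idR flip: monom_altdef)
next
  case (Suc k)
  interpret comm_ring_hom "cycle p :: 'a mpoly \<Rightarrow> _" by (rule comm_ring_hom_cycle)
  let ?c = "\<Sum>j<k. (cycle p ^^ j) (mvar 0) :: 'a mpoly"
  have sum: "cycle p ?c + mvar 0 = (\<Sum>j<Suc k. (cycle p ^^ j) (mvar 0))"
    by (subst sum.lessThan_Suc_shift) (simp add: hom_sum add.commute)
  have "(shear p ^^ Suc k) P = pcompose (pcompose (map_poly (cycle p) (map_poly (cycle p ^^ k) P)) [:cycle p ?c, 1:]) [:mvar 0, 1:]"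
    by (simp add: Suc shear_def map_poly_pcompose map_poly_pCons_hom)
  also have "\<dots> = pcompose (map_poly (cycle p ^^ Suc k) P) [:cycle p ?c + mvar 0, 1:]"
    by (simp add: map_poly_map_poly pcompose_assoc[symmetric] pcompose_pCons comp_def)
  finally show ?case by (simp only: sum)
qed

definition var_sum :: "nat \<Rightarrow> 'a::field mpoly" where
  "var_sum p = (\<Sum>i<p. mvar i)"

lemma cycle_var_sum: "cycle p (var_sum p) = var_sum p"
proof -
  interpret comm_ring_hom "cycle p :: 'a mpoly \<Rightarrow> _" by (rule comm_ring_hom_cycle)
  have "cycle p (var_sum p :: 'a mpoly) = (\<Sum>i<p. mvar (cyc p i))"
    by (simp add: var_sum_def hom_sum cycle_mvar)
  also have "\<dots> = (\<Sum>i\<in>cyc p ` {..<p}. mvar i)"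
    by (simp add: sum.reindex inj_on_subset[OF inj_cyc])
  finally show ?thesis by (simp add: cyc_image var_sum_def)
qed

lemma shear_funpow_p:
  assumes "p > 0"
  shows "(shear p ^^ p) P = pcompose P [:var_sum p, 1:]"
proof -
  have "(cycle p ^^ p) = (id :: 'a mpoly \<Rightarrow> _)" by (simp add: fun_eq_iff cycle_funpow_p)
  moreover have "(\<Sum>j<p. (cycle p ^^ j) (mvar 0)) = (var_sum p :: 'a mpoly)"
    by (simp add: var_sum_def cycle_funpow_mvar[OF assms])
  ultimately show ?thesis by (simp add: shear_funpow map_poly_id)
qed

lemma var_sum_nonzero: "p > 0 \<Longrightarrow> var_sum p \<noteq> (0 :: 'a::field mpoly)"
proof
  assume p: "p > 0" and 0: "var_sum p = (0 :: 'a mpoly)"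
  have "Poly_Mapping.single 0 (1::nat) = Poly_Mapping.single i 1 \<longleftrightarrow> i = 0" for i :: nat
    by (metis lookup_single_eq lookup_single_not_eq zero_neq_one)
  then have "Poly_Mapping.lookup (var_sum p :: 'a mpoly) (Poly_Mapping.single 0 1) = (\<Sum>i<p. if i = 0 then 1 else 0)"
    by (simp add: var_sum_def lookup_sum lookup_mvar)
  then show False using p 0 by simp
qed

section \<open>An Artin-Schreier polynomial\<close>

text \<open>The product of all \<open>X + j e\<close> with \<open>j\<close> in the prime field, where \<open>e\<close> is the sum of the variables:
  it is the norm of \<open>X\<close> for the group generated by \<open>\<sigma>\<^sup>p\<close>.\<close>

definition artin_schreier :: "nat \<Rightarrow> 'a::field mpoly poly" where
  "artin_schreier p = Polynomial.monom 1 p - Polynomial.monom (var_sum p ^ (p - 1)) 1"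

definition artin_schreier_defect :: "nat \<Rightarrow> 'a::field mpoly" where
  "artin_schreier_defect p = mvar 0 ^ p - var_sum p ^ (p - 1) * mvar 0"

lemma CHAR_mpoly: "CHAR('a::comm_ring_1 mpoly) = CHAR('a)"
proof (rule CHAR_eqI)
  interpret comm_ring_hom "mconst :: 'a \<Rightarrow> _" by (rule comm_ring_hom_mconst)
  have of_nat: "of_nat n = (mconst (of_nat n) :: 'a mpoly)" for n
    by (simp add: hom_of_nat)
  show "of_nat CHAR('a) = (0 :: 'a mpoly)" by (simp add: of_nat)
  fix n assume "of_nat n = (0 :: 'a mpoly)"
  then have "of_nat n = (0 :: 'a)"
    by (metis of_nat mconst_def lookup_single_eq lookup_zero)
  then show "CHAR('a) dvd n" by (simp add: of_nat_eq_0_iff_char_dvd)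
qed

lemma hpoly_var_sum: "var_sum p \<in> hpoly p 1"
  unfolding var_sum_def by (rule hpoly_sum, rule hpoly_mvar) simp

lemma artin_schreier_in_gpoly: "p > 0 \<Longrightarrow> (artin_schreier p :: 'a::field mpoly poly) \<in> gpoly p p"
proof -
  assume p: "p > 0"
  have "Polynomial.monom (1 :: 'a mpoly) p \<in> gpoly p (0 + p)"
    by (rule gpoly_monom) simp
  moreover have "- Polynomial.monom (var_sum p ^ (p - 1) :: 'a mpoly) 1 \<in> gpoly p ((p - 1) * 1 + 1)"
    by (intro gpoly_uminus gpoly_monom hpoly_power hpoly_var_sum)
  ultimately show ?thesis
    unfolding artin_schreier_def using gpoly_add p by force
qed

lemma coeff_artin_schreier_top: "p \<ge> 2 \<Longrightarrow> coeff (artin_schreier p) p = 1"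
  by (simp add: artin_schreier_def coeff_monom)

lemma degree_artin_schreier:
  assumes "p \<ge> 2"
  shows "degree (artin_schreier p :: 'a::field mpoly poly) = p"
proof (rule antisym)
  show "degree (artin_schreier p :: 'a mpoly poly) \<le> p"
    using artin_schreier_in_gpoly[of p, where 'a = 'a] assms by (simp add: gpoly_def)
  show "p \<le> degree (artin_schreier p :: 'a mpoly poly)"
    by (rule le_degree) (simp add: coeff_artin_schreier_top[OF assms])
qed

lemma freshman_linear_poly:
  fixes c :: "'a::field mpoly"
  assumes "prime p" "CHAR('a) = p"
  shows "[:c, 1:] ^ p = Polynomial.monom 1 p + [:c ^ p:]"
proof -
  have "[:c, 1:] ^ p = (Polynomial.monom 1 1 + [:c:]) ^ p" by (simp add: monom_altdef)
  also have "\<dots> = Polynomial.monom 1 1 ^ p + [:c:] ^ p"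
    by (rule freshmans_dream) (use assms in \<open>simp_all add: CHAR_mpoly\<close>)
  finally show ?thesis by (simp add: monom_power poly_const_pow)
qed

text \<open>By the Frobenius map the polynomial is additive in its argument.\<close>

lemma pcompose_artin_schreier:
  fixes c :: "'a::field mpoly"
  assumes "prime p" "CHAR('a) = p"
  shows "pcompose (artin_schreier p) [:c, 1:] = artin_schreier p + [:c ^ p - var_sum p ^ (p - 1) * c:]"
proof -
  have "artin_schreier p = [:0, 1:] ^ p - Polynomial.smult (var_sum p ^ (p - 1)) ([:0, 1:] :: 'a mpoly poly)"
    by (simp add: artin_schreier_def monom_altdef)
  then have "pcompose (artin_schreier p) [:c, 1:] = [:c, 1:] ^ p - Polynomial.smult (var_sum p ^ (p - 1)) [:c, 1:]"
    by (simp add: pcompose_diff pcompose_smult pcompose_pCons pcompose_hom.hom_power)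
  also have "Polynomial.smult (var_sum p ^ (p - 1)) [:c, 1:]
      = Polynomial.monom (var_sum p ^ (p - 1)) 1 + [:var_sum p ^ (p - 1) * c:]"
    by (simp add: monom_altdef)
  also have "[:c, 1:] ^ p - \<dots> = artin_schreier p + ([:c ^ p:] - [:var_sum p ^ (p - 1) * c:])"
    unfolding artin_schreier_def freshman_linear_poly[OF assms] by (rule add_diff_add)
  finally show ?thesis by simp
qed

lemma shear_artin_schreier:
  assumes "prime p" "CHAR('a::field) = p"
  shows "shear p (artin_schreier p) = artin_schreier p + [:artin_schreier_defect p :: 'a mpoly:]"
proof -
  interpret comm_ring_hom "cycle p :: 'a mpoly \<Rightarrow> _" by (rule comm_ring_hom_cycle)
  interpret h: comm_ring_hom "map_poly (cycle p :: 'a mpoly \<Rightarrow> _)"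
    by (rule comm_ring_hom_map_poly, rule comm_ring_hom_cycle)
  have "map_poly (cycle p) (artin_schreier p :: 'a mpoly poly) = artin_schreier p"
    unfolding artin_schreier_def h.hom_minus map_poly_hom_monom hom_power cycle_var_sum by simp
  then show ?thesis
    by (simp add: shear_def pcompose_artin_schreier[OF assms] artin_schreier_defect_def)
qed

lemma shear_funpow_p_artin_schreier:
  assumes "prime p" "CHAR('a::field) = p"
  shows "(shear p ^^ p) (artin_schreier p) = (artin_schreier p :: 'a mpoly poly)"
proof -
  have "p > 0" using assms(1) by (rule prime_gt_0_nat)
  have "var_sum p ^ p - var_sum p ^ (p - 1) * var_sum p = (0 :: 'a mpoly)"
    unfolding power_minus_mult[OF \<open>p > 0\<close>] by simp
  then show ?thesis
    unfolding shear_funpow_p[OF \<open>p > 0\<close>] pcompose_artin_schreier[OF assms] by simp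
qed

lemma mvar_power: "mvar i ^ k = Poly_Mapping.single (Poly_Mapping.single i k) (1 :: 'a::comm_ring_1)"
proof (induction k)
  case (Suc k)
  have "Poly_Mapping.single i 1 + Poly_Mapping.single i k = Poly_Mapping.single i (Suc k)"
    by (rule poly_mapping_eqI) (simp add: lookup_add lookup_single when_def)
  then show ?case unfolding power_Suc Suc.IH by (simp add: mvar_def mult_single)
qed simp

text \<open>The power \<open>z\<^sub>0\<^sup>p\<close> does not contribute because \<open>p \<ge> 2\<close>. In the other term the factor \<open>z\<^sub>0\<close> leaves a
  squarefree monomial in the remaining \<open>p - 1\<close> variables, to be found in the \<open>(p - 1)\<close>-st power of
  the sum of the variables.\<close>

lemma lookup_artin_schreier_defect:
  assumes "p \<ge> 2"
  shows "Poly_Mapping.lookup (artin_schreier_defect p) (const_monom p 1) = - (of_nat (fact (p - 1)) :: 'a::field)"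
proof -
  have "const_monom p 1 \<noteq> Poly_Mapping.single 0 p"
  proof
    assume "const_monom p 1 = Poly_Mapping.single 0 p"
    from arg_cong[OF this, of "\<lambda>m. Poly_Mapping.lookup m 1"] show False using assms by (simp add: lookup_const_monom lookup_single)
  qed
  then have 1: "Poly_Mapping.lookup (mvar 0 ^ p :: 'a mpoly) (const_monom p 1) = 0"
    by (simp add: mvar_power lookup_single_not_eq)
  have "const_monom p 1 - Poly_Mapping.single 0 1 = (\<Sum>j\<in>{1..<p}. Poly_Mapping.single j 1)"
  proof -
    have "{..<p} - {0} = {1..<p}" by auto
    then show ?thesis
      using assms unfolding const_monom_def by (subst sum.remove[of _ 0]) auto
  qed
  moreover have "0 \<in> Poly_Mapping.keys (const_monom p 1)"
    using assms by (simp add: in_keys_iff lookup_const_monom)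
  ultimately have "Poly_Mapping.lookup (mvar 0 * var_sum p ^ (p - 1) :: 'a mpoly) (const_monom p 1)
      = Poly_Mapping.lookup (var_sum p ^ (p - 1)) (\<Sum>j\<in>{1..<p}. Poly_Mapping.single j 1)"
    by (simp only: lookup_mvar_mult if_True)
  also have "\<dots> = of_nat (fact (p - 1))"
    using lookup_sum_mvar_power[of "{..<p}" "{1..<p}"] by (simp add: var_sum_def subset_iff)
  finally show ?thesis
    by (simp add: artin_schreier_defect_def lookup_minus 1[unfolded One_nat_def] mult.commute)
qed

lemma coeff_shear_funpow_top:
  assumes "degree P \<le> k"
  shows "degree ((shear p ^^ j) P) \<le> k \<and> coeff ((shear p ^^ j) P) k = (cycle p ^^ j) (coeff P k)"
proof (induction j)
  case (Suc j)
  interpret comm_ring_hom "cycle p :: 'a mpoly \<Rightarrow> _" by (rule comm_ring_hom_cycle)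
  have "degree (shear p Q) \<le> k" if "degree Q \<le> k" for Q :: "'a mpoly poly"
    using that by (intro degree_le) (simp add: coeff_shear_top coeff_eq_0)
  then show ?case using Suc by (simp add: coeff_shear_top)
qed (use assms in simp)

section \<open>Coordinates on the space of invariants\<close>

text \<open>The leading terms \<open>m X\<^sup>N\<close> of invariants of degree \<open>d\<close>, one monomial \<open>m\<close> being chosen from
  each orbit.\<close>

definition coords :: "nat \<Rightarrow> nat \<Rightarrow> (monom \<times> nat) set" where
  "coords p d = {(m, N). Poly_Mapping.keys m \<subseteq> {..<p} \<and> monom_degree m + N = d \<and>
     (orbit_min p m \<and> p dvd N \<or> rot p m = m \<and> p\<^sup>2 dvd N)}"

text \<open>The leading coefficient \<open>a\<close> of a nonzero invariant is constant on orbits. If the coordinates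
  vanish, no orbit of length \<open>p\<close> contributes to it, so \<open>a = \<alpha> u\<^sup>k\<close> by homogeneity, with \<open>X\<close>-degree
  \<open>p n\<close> and \<open>n\<close> prime to \<open>p\<close>. The second coefficient then contradicts
  \<open>lookup_artin_schreier_defect\<close>.\<close>

lemma invariant_zero_if_coords_zero:
  fixes P :: "'a::field mpoly poly"
  assumes prime: "prime p" and char: "CHAR('a) = p"
    and P: "P \<in> gpoly p d" and inv: "shear p P = P"
    and zero: "\<And>m N. (m, N) \<in> coords p d \<Longrightarrow> Poly_Mapping.lookup (coeff P N) m = 0"
  shows "P = 0"
proof (rule ccontr)
  assume "P \<noteq> 0"
  have p: "p \<ge> 2" using prime by (rule prime_ge_2_nat)
  interpret S: comm_ring_hom "shear p :: 'a mpoly poly \<Rightarrow> _" by (rule comm_ring_hom_shear)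
  interpret M: comm_ring_hom "mconst :: 'a \<Rightarrow> _" by (rule comm_ring_hom_mconst)
  have inv_p: "p dvd degree Q" if "(shear p ^^ p) Q = Q" for Q :: "'a mpoly poly"
    using translation_invariant_imp_char_dvd_degree[of Q "var_sum p"] that p
    by (simp add: shear_funpow_p var_sum_nonzero CHAR_mpoly char)
  have inv_iter: "(shear p ^^ k) P = P" for k by (induction k) (simp_all add: inv)
  obtain n where N: "degree P = p * n" using inv_p[OF inv_iter] by (auto simp: dvd_def)
  define a where "a = coeff P (p * n)"
  have "a \<noteq> 0" using \<open>P \<noteq> 0\<close> by (metis N a_def leading_coeff_0_iff)
  have "degree P \<le> d" using P by (simp add: gpoly_def)
  then have a: "a \<in> hpoly p (d - p * n)" using P N by (simp add: gpoly_def a_def)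
  have rot_a: "Poly_Mapping.lookup a (rot p m) = Poly_Mapping.lookup a m" for m
    using coeff_shear_top[of P "p * n" p] inv N by (simp add: a_def flip: lookup_cycle)
  have rot_a_iter: "Poly_Mapping.lookup a ((rot p ^^ k) m) = Poly_Mapping.lookup a m" for k m
    by (induction k) (simp_all add: rot_a)
  have fixed: "rot p m = m" if "m \<in> Poly_Mapping.keys a" for m
  proof (rule ccontr)
    assume "rot p m \<noteq> m"
    moreover have "p > 0" using p by simp
    ultimately obtain k m' where m': "orbit_min p m'" "k < p" "m = (rot p ^^ k) m'"
      by (rule orbit_min_exists)
    then have "m' \<in> Poly_Mapping.keys a" using that rot_a_iter by (simp add: in_keys_iff)
    then have "(m', p * n) \<in> coords p d"
      using hpolyD[OF a] m'(1) \<open>degree P \<le> d\<close> N by (auto simp: coords_def)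
    then show False using zero \<open>m' \<in> Poly_Mapping.keys a\<close> by (auto simp: a_def in_keys_iff)
  qed
  have const: "\<exists>k. m = const_monom p k \<and> p * k = d - p * n" if "m \<in> Poly_Mapping.keys a" for m
    using rot_fixed_iff[OF hpolyD(1)[OF a that]] fixed[OF that] hpolyD(2)[OF a that]
      monom_degree_const_monom by metis
  obtain k where k: "const_monom p k \<in> Poly_Mapping.keys a" "p * k = d - p * n"
    using const \<open>a \<noteq> 0\<close> by (metis all_not_in_conv keys_eq_empty)
  have keys_a: "Poly_Mapping.keys a \<subseteq> {const_monom p k}"
  proof
    fix m assume "m \<in> Poly_Mapping.keys a"
    then obtain k' where "m = const_monom p k'" "p * k' = d - p * n" using const by blast
    then have "m = const_monom p k'" "p * k' = p * k" using k(2) by simp_all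
    then show "m \<in> {const_monom p k}" using p by simp
  qed
  define \<alpha> where "\<alpha> = Poly_Mapping.lookup a (const_monom p k)"
  have a_single: "a = Poly_Mapping.single (const_monom p k) \<alpha>"
  proof (rule poly_mapping_eqI)
    fix m
    show "Poly_Mapping.lookup a m = Poly_Mapping.lookup (Poly_Mapping.single (const_monom p k) \<alpha>) m"
      using keys_a by (cases "m = const_monom p k") (auto simp: \<alpha>_def lookup_single in_keys_iff)
  qed
  have "\<alpha> \<noteq> 0" using k(1) by (simp add: \<alpha>_def in_keys_iff)
  have "\<not> p dvd n"
  proof
    assume "p dvd n"
    then have "(const_monom p k, p * n) \<in> coords p d"
      using k(2) \<open>degree P \<le> d\<close> N keys_const_monom[of p k] rot_fixed_iff[OF keys_const_monom, of p k]
      by (auto simp: coords_def monom_degree_const_monom power2_eq_square)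
    then show False using zero \<open>\<alpha> \<noteq> 0\<close> by (auto simp: \<alpha>_def a_def)
  qed
  then have n: "n > 0" by (auto intro: Nat.gr0I)
  let ?Y = "artin_schreier p :: 'a mpoly poly"
  \<comment> \<open>Removing the leading term by a \<open>\<sigma>\<^sup>p\<close>-invariant keeps the degree a multiple of \<open>p\<close>, so that it
    drops by at least \<open>p\<close> and the next relevant coefficient is the one at \<open>p (n - 1)\<close>.\<close>
  define Q where "Q = P - [:a:] * ?Y ^ n"
  have cycle_a: "cycle p a = a"
    by (rule poly_mapping_eqI) (simp add: lookup_cycle rot_a)
  have "(shear p ^^ p) Q = Q"
  proof -
    interpret Sp: comm_ring_hom "shear p ^^ p :: 'a mpoly poly \<Rightarrow> _"
      by (rule comm_ring_hom_funpow, rule comm_ring_hom_shear)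
    have "(shear p ^^ i) [:a:] = [:a:]" for i by (induction i) (simp_all add: shear_const cycle_a)
    then show ?thesis
      by (simp only: Q_def Sp.hom_minus Sp.hom_mult Sp.hom_power inv_iter shear_funpow_p_artin_schreier[OF prime char])
  qed
  then have "p dvd degree Q" by (rule inv_p)
  moreover have degY: "degree (?Y ^ n) = p * n"
    using degree_artin_schreier[OF p, where 'a = 'a] p by (subst degree_power_eq) auto
  moreover have "lead_coeff (?Y ^ n) = 1"
    using degree_artin_schreier[OF p, where 'a = 'a] coeff_artin_schreier_top[OF p, where 'a = 'a] by (simp add: lead_coeff_power)
  ultimately have degQ: "degree Q \<le> p * (n - 1)"
  proof -
    have "degree Q \<le> p * n"
      unfolding Q_def using N degY by (intro degree_diff_le) auto
    moreover have "coeff Q (p * n) = 0"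
      using \<open>lead_coeff (?Y ^ n) = 1\<close> degY by (simp add: Q_def a_def)
    ultimately have "degree Q < p * n \<or> Q = 0"
      using eq_zero_or_degree_less by blast
    then show ?thesis
    proof
      assume "degree Q < p * n"
      moreover obtain j where j: "degree Q = p * j" using \<open>p dvd degree Q\<close> by (auto simp: dvd_def)
      ultimately have "j < n" by simp
      then show ?thesis unfolding j by (intro mult_le_mono) auto
    qed simp
  qed
  have shear_Q: "shear p Q = P - [:a:] * (?Y + [:artin_schreier_defect p:]) ^ n"
    by (simp only: Q_def S.hom_minus S.hom_mult S.hom_power inv shear_const cycle_a
        shear_artin_schreier[OF prime char])
  have diff: "shear p Q - Q = - ([:a:] * ((?Y + [:artin_schreier_defect p:]) ^ n - ?Y ^ n))"
    unfolding shear_Q unfolding Q_def right_diff_distrib by simp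
  have "coeff ((?Y + [:artin_schreier_defect p:]) ^ n - ?Y ^ n) (p * (n - 1)) = of_nat n * artin_schreier_defect p"
    using coeff_power_add_const_diff[of ?Y n "artin_schreier_defect p"] n p coeff_artin_schreier_top[OF p, where 'a = 'a]
      degree_artin_schreier[OF p, where 'a = 'a] by simp
  with arg_cong[OF diff, of "\<lambda>R. coeff R (p * (n - 1))"]
  have "cycle p (coeff Q (p * (n - 1))) - coeff Q (p * (n - 1)) = - (a * (of_nat n * artin_schreier_defect p))"
    using coeff_shear_top[OF degQ, of p] by simp
  \<comment> \<open>At a monomial fixed by the rotation the left-hand side vanishes.\<close>
  then have "Poly_Mapping.lookup (cycle p (coeff Q (p * (n - 1))) - coeff Q (p * (n - 1))) (const_monom p (k + 1))
      = - Poly_Mapping.lookup (a * (of_nat n * artin_schreier_defect p)) (const_monom p k + const_monom p 1)"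
    by (simp only: lookup_uminus const_monom_add)
  moreover have "rot p (const_monom p (k + 1)) = const_monom p (k + 1)"
    using rot_fixed_iff[OF keys_const_monom] by blast
  ultimately have "Poly_Mapping.lookup (a * (of_nat n * artin_schreier_defect p)) (const_monom p k + const_monom p 1) = 0"
    by (simp add: lookup_minus lookup_cycle)
  moreover have "Poly_Mapping.lookup (of_nat n * artin_schreier_defect p) (const_monom p 1)
      = (of_nat n * - of_nat (fact (p - 1)) :: 'a)"
  proof -
    have "of_nat n * artin_schreier_defect p = Poly_Mapping.single 0 (of_nat n) * (artin_schreier_defect p :: 'a mpoly)"
      by (simp only: M.hom_of_nat[symmetric] mconst_def)
    then show ?thesis
      using lookup_single_mult[of 0 "of_nat n" "artin_schreier_defect p :: 'a mpoly" "const_monom p 1"]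
      by (simp only: add_0 lookup_artin_schreier_defect[OF p])
  qed
  ultimately have "\<alpha> * (of_nat n * - of_nat (fact (p - 1))) = 0"
    by (simp only: a_single lookup_single_mult)
  moreover have "of_nat n \<noteq> (0 :: 'a)"
    using \<open>\<not> p dvd n\<close> char by (simp add: of_nat_eq_0_iff_char_dvd)
  moreover have "of_nat (fact (p - 1)) \<noteq> (0 :: 'a)"
    using prime p by (simp add: of_nat_eq_0_iff_char_dvd char prime_dvd_fact_iff del: of_nat_fact)
  ultimately show False using \<open>\<alpha> \<noteq> 0\<close> by simp
qed

lemma hom_orbit_sum_fixed:
  assumes "comm_ring_hom h" "(h ^^ p) x = x"
  shows "h (\<Sum>i<p. (h ^^ i) x) = (\<Sum>i<p. (h ^^ i) x)"
proof -
  interpret comm_ring_hom h by fact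
  show ?thesis
  proof (cases p)
    case (Suc q)
    have "h (\<Sum>i<p. (h ^^ i) x) = (\<Sum>i<q. (h ^^ Suc i) x) + x"
      using assms(2) by (simp add: hom_sum hom_add Suc)
    then show ?thesis unfolding Suc by (subst sum.lessThan_Suc_shift) (simp add: add.commute)
  qed simp
qed

lemma hom_orbit_prod_fixed:
  assumes "comm_ring_hom h" "(h ^^ p) x = x"
  shows "h (\<Prod>i<p. (h ^^ i) x) = (\<Prod>i<p. (h ^^ i) x)"
proof -
  interpret comm_ring_hom h by fact
  show ?thesis
  proof (cases p)
    case (Suc q)
    have "h (\<Prod>i<p. (h ^^ i) x) = (\<Prod>i<q. (h ^^ Suc i) x) * x"
      using assms(2) by (simp add: hom_prod hom_mult Suc)
    then show ?thesis unfolding Suc by (subst prod.lessThan_Suc_shift) (simp add: mult.commute)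
  qed simp
qed

text \<open>For an orbit of length \<open>p\<close> the invariant is the sum of the conjugates of \<open>m Y\<^sup>n\<close>, whose leading
  coefficient is the orbit sum of \<open>m\<close>. For a fixed monomial it is \<open>m\<close> times a power of the product of
  the \<open>p\<close> conjugates of \<open>Y\<close>, which is monic of degree \<open>p\<^sup>2\<close>.\<close>

lemma invariant_with_coord:
  assumes prime: "prime p" and char: "CHAR('a::field) = p" and mN: "(m, N) \<in> coords p d"
  obtains Q where "Q \<in> gpoly p d" "shear p Q = Q" "Poly_Mapping.lookup (coeff Q N) m = (1 :: 'a)"
    "\<And>m' N'. (m', N') \<in> coords p d \<Longrightarrow> N' \<ge> N \<Longrightarrow> (m', N') \<noteq> (m, N) \<Longrightarrow>
      Poly_Mapping.lookup (coeff Q N') m' = 0"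
proof -
  have p: "p \<ge> 2" using prime by (rule prime_ge_2_nat)
  interpret S: comm_ring_hom "shear p :: 'a mpoly poly \<Rightarrow> _" by (rule comm_ring_hom_shear)
  interpret Sp: comm_ring_hom "shear p ^^ p :: 'a mpoly poly \<Rightarrow> _"
    by (rule comm_ring_hom_funpow, rule comm_ring_hom_shear)
  let ?Y = "artin_schreier p :: 'a mpoly poly"
  have Y: "?Y \<in> gpoly p p" using p by (intro artin_schreier_in_gpoly) simp
  have degY: "degree ?Y = p" and coeffY: "coeff ?Y p = 1"
    using degree_artin_schreier[OF p] coeff_artin_schreier_top[OF p] by auto
  have m: "Poly_Mapping.keys m \<subseteq> {..<p}" "monom_degree m + N = d"
    using mN by (auto simp: coords_def)
  let ?u = "Poly_Mapping.single m (1 :: 'a)"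
  have u: "[:?u:] \<in> gpoly p (monom_degree m)"
    using m by (intro gpoly_const hpoly_single)
  consider "orbit_min p m" "p dvd N" | "rot p m = m" "p\<^sup>2 dvd N"
    using mN by (auto simp: coords_def)
  then show thesis
  proof cases
    case 1
    then obtain n where n: "N = n * p" by (metis dvd_def mult.commute)
    let ?T = "[:?u:] * ?Y ^ n"
    define Q where "Q = (\<Sum>i<p. (shear p ^^ i) ?T)"
    have T: "?T \<in> gpoly p d"
      using gpoly_mult[OF u gpoly_power[OF Y, of n]] m(2) n by simp
    have "(shear p ^^ p) [:?u:] = [:?u:]"
      using p by (simp add: shear_funpow_p)
    then have "(shear p ^^ p) ?T = ?T"
      by (simp only: Sp.hom_mult Sp.hom_power shear_funpow_p_artin_schreier[OF prime char])
    then have "shear p Q = Q"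
      unfolding Q_def by (rule hom_orbit_sum_fixed[OF comm_ring_hom_shear])
    moreover have "Q \<in> gpoly p d"
      unfolding Q_def using p T by (intro gpoly_sum shear_funpow_in_gpoly) auto
    moreover have degT: "degree ?T \<le> N"
      using degree_mult_le[of "[:?u:]" "?Y ^ n"] degree_power_le[of ?Y n] degY n by (simp add: mult.commute)
    have "coeff (?Y ^ n) N = 1"
    proof -
      have "?Y \<noteq> 0" using degY p by auto
      then have "degree (?Y ^ n) = N" by (simp add: degree_power_eq degY n)
      then show ?thesis using coeffY degY by (metis lead_coeff_power power_one)
    qed
    then have coeffT: "coeff ?T N = ?u" by simp
    have "Poly_Mapping.lookup (coeff ((shear p ^^ i) ?T) N) m' = (if (rot p ^^ i) m' = m then 1 else 0)" for i m'
      unfolding coeff_shear_funpow_top[OF degT, THEN conjunct2] coeffT lookup_cycle_funpow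
      by (simp add: lookup_single when_def eq_commute)
    then have lookQ: "Poly_Mapping.lookup (coeff Q N) m' = (\<Sum>i<p. if (rot p ^^ i) m' = m then 1 else 0)" for m'
      by (simp only: Q_def coeff_sum lookup_sum)
    have "Poly_Mapping.lookup (coeff Q N) m = 1"
    proof -
      have "(rot p ^^ i) m = m \<longleftrightarrow> i = 0" if "i < p" for i
        using rot_funpow_fixed_imp_dvd[OF prime, of m i] 1(1) that
        by (auto simp: orbit_min_def dest: nat_dvd_not_less)
      then have "Poly_Mapping.lookup (coeff Q N) m = (\<Sum>i<p. if i = 0 then 1 else 0)"
        unfolding lookQ by (intro sum.cong) auto
      then show ?thesis using p by simp
    qed
    moreover have "Poly_Mapping.lookup (coeff Q N') m' = 0"
      if "(m', N') \<in> coords p d" "N' \<ge> N" "(m', N') \<noteq> (m, N)" for m' N'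
    proof (cases "N' = N")
      case False
      have "coeff ((shear p ^^ i) ?T) N' = 0" for i
        using coeff_shear_funpow_top[OF degT, THEN conjunct1, of i p] that(2) False
        by (intro coeff_eq_0) linarith
      then have "coeff Q N' = 0"
        unfolding Q_def coeff_sum by (intro sum.neutral ballI)
      then show ?thesis by simp
    next
      case True
      have "(rot p ^^ i) m' \<noteq> m" for i
      proof
        assume eq: "(rot p ^^ i) m' = m"
        show False
        proof (cases "rot p m' = m'")
          case True
          have "(rot p ^^ j) m' = m'" for j by (induction j) (simp_all add: True)
          then show False using eq True 1(1) by (simp add: orbit_min_def)
        next
          case False
          then have "orbit_min p m'" using that(1) by (auto simp: coords_def)
          then have "m' = m" using orbit_min_unique[OF _ 1(1) eq] p by simp
          then show False using that(3) True by simp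
        qed
      qed
      then show ?thesis by (simp add: True lookQ)
    qed
    ultimately show thesis by (intro that[of Q])
  next
    case 2
    then obtain b where b: "N = b * p\<^sup>2" by (metis dvd_def mult.commute)
    define norm where "norm = (\<Prod>i<p. (shear p ^^ i) ?Y)"
    define Q where "Q = [:?u:] * norm ^ b"
    have "cycle p ?u = ?u"
    proof (rule poly_mapping_eqI)
      fix n
      have "rot p n = m \<longleftrightarrow> n = m" using inj_eq[OF inj_rot, of p n m] 2(1) by simp
      then show "Poly_Mapping.lookup (cycle p ?u) n = Poly_Mapping.lookup ?u n"
        by (auto simp: lookup_cycle lookup_single when_def)
    qed
    moreover have "shear p norm = norm"
      unfolding norm_def by (rule hom_orbit_prod_fixed[OF comm_ring_hom_shear shear_funpow_p_artin_schreier[OF prime char]])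
    ultimately have "shear p Q = Q"
      by (simp only: Q_def S.hom_mult S.hom_power shear_const)
    moreover have "norm \<in> gpoly p (card {..<p} * p)"
      unfolding norm_def using p Y by (intro gpoly_prod shear_funpow_in_gpoly) auto
    then have "Q \<in> gpoly p (monom_degree m + b * (card {..<p} * p))"
      unfolding Q_def by (intro gpoly_mult u gpoly_power)
    then have "Q \<in> gpoly p d" using m(2) b by (simp add: power2_eq_square)
    moreover have monic: "degree ((shear p ^^ i) ?Y) = p \<and> lead_coeff ((shear p ^^ i) ?Y) = 1" for i
    proof -
      interpret C: comm_ring_hom "cycle p ^^ i :: 'a mpoly \<Rightarrow> _"
        by (rule comm_ring_hom_funpow, rule comm_ring_hom_cycle)
      have "degree ((shear p ^^ i) ?Y) \<le> p" "coeff ((shear p ^^ i) ?Y) p = 1"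
        using coeff_shear_funpow_top[where P = ?Y and k = p and p = p and j = i] degY coeffY by auto
      then show ?thesis using le_degree[of "(shear p ^^ i) ?Y" p] by auto
    qed
    have nonzero: "(shear p ^^ i) ?Y \<noteq> 0" for i
      using monic[of i] p by (metis degree_0 not_numeral_le_zero)
    have lead_norm: "lead_coeff norm = 1" unfolding norm_def lead_coeff_prod
      using monic by (intro prod.neutral ballI) blast
    have deg_norm: "degree norm = p\<^sup>2"
      unfolding norm_def using nonzero monic by (subst degree_prod_eq_sum_degree) (auto simp: power2_eq_square)
    have "norm \<noteq> 0" using lead_norm by auto
    then have deg_pow: "degree (norm ^ b) = N" by (simp add: degree_power_eq deg_norm b)
    then have coeff_pow: "coeff (norm ^ b) N = 1" using lead_norm by (metis lead_coeff_power power_one)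
    have degQ: "degree Q \<le> N"
      using degree_mult_le[of "[:?u:]" "norm ^ b"] deg_pow by (simp add: Q_def)
    have coeffQ: "coeff Q N = ?u" by (simp add: Q_def coeff_pow)
    have "Poly_Mapping.lookup (coeff Q N') m' = 0"
      if "N' \<ge> N" "(m', N') \<noteq> (m, N)" for m' N'
      using that degQ by (cases "N' = N") (auto simp: coeffQ lookup_single_not_eq coeff_eq_0)
    moreover have "Poly_Mapping.lookup (coeff Q N) m = 1" by (simp add: coeffQ)
    ultimately show thesis by (intro that[of Q])
  qed
qed

section \<open>Straightening the action\<close>

text \<open>The pullback of the coordinate function \<open>x\<^sub>i\<close> along the Jordan block.\<close>

definition gen_image :: "nat \<Rightarrow> nat \<Rightarrow> 'a::field mpoly" where
  "gen_image p i = (if i < p then mvar i + mvar (Suc i) else mvar i)"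

definition gen_act :: "nat \<Rightarrow> 'a::field mpoly \<Rightarrow> 'a mpoly" where
  "gen_act p = poly_subst (gen_image p)"

lemma comm_ring_hom_gen_act: "comm_ring_hom (gen_act p)"
  unfolding gen_act_def by (rule comm_ring_hom_poly_subst)

lemma coord_pullback_jordan_block:
  assumes "i < p + 1"
  shows "coord_pullback (p + 1) (jordan_block (p + 1) 1) i = (gen_image p i :: 'a::field mpoly)"
proof -
  have "coord_pullback (p + 1) (jordan_block (p + 1) 1) i
      = (\<Sum>j<p + 1. (if j = i then mvar i else 0) + (if j = Suc i then mvar (Suc i) else 0) :: 'a mpoly)"
    unfolding coord_pullback_def using assms
    by (intro sum.cong refl) (auto simp: jordan_block_def mscale_def mconst_simps)
  also have "\<dots> = gen_image p i"
    using assms by (simp add: sum.distrib gen_image_def del: sum.lessThan_Suc)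
  finally show ?thesis .
qed

text \<open>Group elements act through the powers of the Jordan block attached to their inverses, so the Jordan
  block itself belongs to the inverse of the generator \<open>1\<close>; it generates the action.\<close>

lemma V_invariants_eq:
  assumes "prime p"
  shows "V_invariants p = {f \<in> poly_ring (p + 1). gen_act p f = (f :: 'a::field mpoly)}"
proof (intro equalityI subsetI)
  let ?G = "integer_mod_group (p\<^sup>2)" and ?J = "jordan_block (p + 1) 1 :: 'a mat"
  interpret G: group ?G by simp
  have p: "p \<ge> 2" using assms by (rule prime_ge_2_nat)
  have J: "?J \<in> carrier_mat (p + 1) (p + 1)" by simp
  fix f :: "'a mpoly"
  {
    assume f: "f \<in> V_invariants p"
    have "1 < int (p\<^sup>2)" using p by (simp add: one_less_power)
    then have one: "1 \<in> carrier ?G" by (auto simp: carrier_integer_mod_group)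
    have "V_act p (inv\<^bsub>?G\<^esub> 1) f = f"
      using f G.inv_closed[OF one] by (auto simp: V_invariants_def)
    then have "poly_subst (coord_pullback (p + 1) (V_rep p 1)) f = f"
      by (simp add: V_act_def G.inv_inv[OF one])
    moreover have "V_rep p 1 = ?J"
      using J by (simp add: V_rep_def)
    moreover have "f \<in> poly_ring (p + 1)" using f by (simp add: V_invariants_def)
    moreover have "poly_subst (coord_pullback (p + 1) ?J) f = gen_act p f"
      unfolding gen_act_def by (rule poly_subst_cong[OF \<open>f \<in> poly_ring (p + 1)\<close> coord_pullback_jordan_block])
    ultimately show "f \<in> {f \<in> poly_ring (p + 1). gen_act p f = f}" by simp
  }
  {
    assume f: "f \<in> {f \<in> poly_ring (p + 1). gen_act p f = f}"
    then have ring: "f \<in> poly_ring (p + 1)" by simp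
    have gen: "poly_subst (coord_pullback (p + 1) ?J) f = f"
      using f poly_subst_cong[OF ring coord_pullback_jordan_block] by (simp add: gen_act_def)
    have pow: "poly_subst (coord_pullback (p + 1) (?J ^\<^sub>m k)) f = f" for k
    proof (induction k)
      case 0
      have "poly_subst (coord_pullback (p + 1) (1\<^sub>m (p + 1))) f = poly_subst mvar f"
        by (rule poly_subst_cong[OF ring coord_pullback_one])
      then show ?case by (simp add: poly_subst_id)
    next
      case (Suc k)
      have Jk: "?J ^\<^sub>m k \<in> carrier_mat (p + 1) (p + 1)" using J by (rule pow_carrier_mat)
      have "poly_subst (coord_pullback (p + 1) (?J ^\<^sub>m Suc k)) f
          = poly_subst (\<lambda>i. poly_subst (coord_pullback (p + 1) ?J) (coord_pullback (p + 1) (?J ^\<^sub>m k) i)) f"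
        using coord_pullback_mult[OF Jk J] by (intro poly_subst_cong[OF ring]) simp
      also have "\<dots> = poly_subst (coord_pullback (p + 1) ?J) (poly_subst (coord_pullback (p + 1) (?J ^\<^sub>m k)) f)"
        by (rule poly_subst_subst[symmetric])
      also have "\<dots> = f" by (simp only: Suc gen)
      finally show ?case .
    qed
    then show "f \<in> V_invariants p"
      using ring by (simp add: V_invariants_def V_act_def V_rep_def)
  }
qed

text \<open>The binomial theorem for \<open>h = 1 + (h - 1)\<close> in the ring of additive maps.\<close>

lemma hom_funpow_binomial:
  fixes h :: "'b::comm_ring_1 \<Rightarrow> 'b"
  assumes "comm_ring_hom h"
  shows "(h ^^ n) x = (\<Sum>k\<le>n. of_nat (n choose k) * ((\<lambda>y. h y - y) ^^ k) x)"
proof (induction n)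
  case (Suc n)
  interpret comm_ring_hom h by fact
  define d where "d k = ((\<lambda>y. h y - y) ^^ k) x" for k
  have step: "h (d k) = d (Suc k) + d k" for k by (simp add: d_def)
  have "(h ^^ Suc n) x = (\<Sum>k\<le>n. of_nat (n choose k) * h (d k))"
    by (simp add: Suc d_def hom_sum hom_mult hom_of_nat)
  also have "\<dots> = (\<Sum>k\<le>n. of_nat (n choose k) * d (Suc k)) + (\<Sum>k\<le>n. of_nat (n choose k) * d k)"
    by (simp add: step distrib_left sum.distrib)
  also have "(\<Sum>k\<le>n. of_nat (n choose k) * d k) = (\<Sum>k\<le>Suc n. of_nat (n choose k) * d k)"
    by (simp add: binomial_eq_0)
  also have "\<dots> = d 0 + (\<Sum>k\<le>n. of_nat (n choose Suc k) * d (Suc k))"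
    by (subst sum.atMost_Suc_shift) simp
  also have "(\<Sum>k\<le>n. of_nat (n choose k) * d (Suc k)) + (d 0 + (\<Sum>k\<le>n. of_nat (n choose Suc k) * d (Suc k)))
      = d 0 + (\<Sum>k\<le>n. of_nat (Suc n choose Suc k) * d (Suc k))"
    by (simp add: sum.distrib distrib_right)
  also have "\<dots> = (\<Sum>k\<le>Suc n. of_nat (Suc n choose k) * d k)"
    by (subst sum.atMost_Suc_shift) simp
  finally show ?case by (simp only: d_def)
qed simp

text \<open>In characteristic \<open>p\<close> the binomial expansion collapses to \<open>h\<^sup>p = 1 + (h - 1)\<^sup>p\<close>: on any element, \<open>h\<^sup>p\<close> is the identity
  if and only if \<open>(h - 1)\<^sup>p\<close> is zero. One direction is needed for the cyclic permutation, the other for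
  the Jordan block.\<close>

lemma hom_funpow_prime_char:
  fixes h :: "'b::comm_ring_1 \<Rightarrow> 'b"
  assumes "comm_ring_hom h" "prime p" "CHAR('b) = p"
  shows "(h ^^ p) x = x + ((\<lambda>y. h y - y) ^^ p) x"
proof -
  let ?d = "\<lambda>k. ((\<lambda>y. h y - y) ^^ k) x"
  have p: "p > 0" using assms(2) by (rule prime_gt_0_nat)
  have "of_nat (p choose k) = (0 :: 'b)" if "k \<noteq> 0" "k \<noteq> p" "k \<le> p" for k
    unfolding of_nat_eq_0_iff_char_dvd assms(3)
    by (rule dvd_choose_prime) (use that assms(2) in auto)
  then have "(h ^^ p) x = (\<Sum>k\<in>{0, p}. of_nat (p choose k) * ?d k)"
    unfolding hom_funpow_binomial[OF assms(1)] by (intro sum.mono_neutral_right) auto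
  then show ?thesis using p by simp
qed

definition cycle_diff :: "nat \<Rightarrow> 'a::field mpoly \<Rightarrow> 'a mpoly" where
  "cycle_diff p = (\<lambda>f. cycle p f - f)"

text \<open>Since \<open>x\<^sub>k\<^sub>+\<^sub>1 = (\<sigma> - 1)\<^sup>k x\<^sub>1\<close>, sending \<open>x\<^sub>1\<close> to \<open>z\<^sub>0\<close> determines the images of the other
  variables; conversely \<open>z\<^sub>i\<close> corresponds to \<open>\<sigma>\<^sup>i x\<^sub>1\<close>. Described in this way, the two changes of
  coordinates need no explicit binomial coefficients.\<close>

definition straight_image :: "nat \<Rightarrow> nat \<Rightarrow> 'a::field mpoly poly" where
  "straight_image p i = (case i of 0 \<Rightarrow> [:0, 1:] | Suc k \<Rightarrow> [:(cycle_diff p ^^ k) (mvar 0):])"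

definition straighten :: "nat \<Rightarrow> 'a::field mpoly \<Rightarrow> 'a mpoly poly" where
  "straighten p = eval_hom (\<lambda>c. [:mconst c:]) (straight_image p)"

definition unstraighten_vars :: "nat \<Rightarrow> 'a::field mpoly \<Rightarrow> 'a mpoly" where
  "unstraighten_vars p = poly_subst (\<lambda>i. (gen_act p ^^ i) (mvar 1))"

definition unstraighten :: "nat \<Rightarrow> 'a::field mpoly poly \<Rightarrow> 'a mpoly" where
  "unstraighten p P = poly (map_poly (unstraighten_vars p) P) (mvar 0)"

lemma comm_ring_hom_const_poly: "comm_ring_hom (\<lambda>c :: 'b::comm_ring_1. [:c:])"
  by unfold_locales (simp_all add: one_pCons)

lemma comm_ring_hom_const: "comm_ring_hom (\<lambda>c :: 'a::comm_ring_1. [:mconst c:])"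
  by (rule comm_ring_hom_comp[OF comm_ring_hom_const_poly comm_ring_hom_mconst])

lemma comm_ring_hom_straighten: "comm_ring_hom (straighten p)"
  unfolding straighten_def by (rule comm_ring_hom_eval_hom[OF comm_ring_hom_const])

lemma comm_ring_hom_poly_eval: "comm_ring_hom (\<lambda>P :: 'b::comm_ring_1 poly. poly P a)"
  by unfold_locales simp_all

lemma comm_ring_hom_unstraighten_vars: "comm_ring_hom (unstraighten_vars p)"
  unfolding unstraighten_vars_def by (rule comm_ring_hom_poly_subst)

lemma comm_ring_hom_unstraighten: "comm_ring_hom (unstraighten p)"
  unfolding unstraighten_def
  by (rule comm_ring_hom_comp[OF comm_ring_hom_poly_eval comm_ring_hom_map_poly[OF comm_ring_hom_unstraighten_vars]])

lemma straighten_mconst: "straighten p (mconst c) = [:mconst c:]"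
  unfolding straighten_def by (rule eval_hom_mconst[OF comm_ring_hom_const])

lemma straighten_mvar: "straighten p (mvar i) = straight_image p i"
  unfolding straighten_def by (rule eval_hom_mvar[OF comm_ring_hom_const])

lemma gen_mvar: "gen_act p (mvar i) = gen_image p i"
  by (simp add: gen_act_def poly_subst_mvar)

lemma cycle_diff_funpow_in_hpoly:
  assumes "p > 0"
  shows "(cycle_diff p ^^ k) (mvar 0) \<in> hpoly p 1"
proof (induction k)
  case (Suc k)
  then show ?case
    using hpoly_add[OF cycle_in_hpoly[OF Suc] hpoly_uminus[OF Suc]] by (simp add: cycle_diff_def)
qed (use assms hpoly_mvar in auto)

lemma cycle_diff_funpow_p:
  assumes "prime p" "CHAR('a::field) = p"
  shows "(cycle_diff p ^^ p) (mvar 0) = (0 :: 'a mpoly)"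
proof -
  have "(cycle p ^^ p) (mvar 0) = (mvar 0 + (cycle_diff p ^^ p) (mvar 0) :: 'a mpoly)"
    unfolding cycle_diff_def
    by (rule hom_funpow_prime_char[OF comm_ring_hom_cycle assms(1)]) (simp add: CHAR_mpoly assms(2))
  then show ?thesis by (simp add: cycle_funpow_p)
qed

text \<open>The case \<open>i = p\<close> is where \<open>(\<sigma> - 1)\<^sup>p z\<^sub>0 = 0\<close> enters.\<close>

lemma shear_straight_image:
  assumes "prime p" "CHAR('a::field) = p" "i < p + 1"
  shows "shear p (straight_image p i) = (straighten p (gen_image p i) :: 'a mpoly poly)"
proof -
  interpret B: comm_ring_hom "straighten p :: 'a mpoly \<Rightarrow> _" by (rule comm_ring_hom_straighten)
  have p: "p > 0" using assms(1) by (rule prime_gt_0_nat)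
  have cycle_step: "cycle p g = cycle_diff p g + g" for g :: "'a mpoly"
    by (simp add: cycle_diff_def)
  show ?thesis
  proof (cases i)
    case 0
    then show ?thesis
      using p by (simp add: straight_image_def shear_X gen_image_def B.hom_add straighten_mvar)
  next
    case (Suc k)
    have lhs: "shear p (straight_image p i) = [:(cycle_diff p ^^ Suc k) (mvar 0) + (cycle_diff p ^^ k) (mvar 0) :: 'a mpoly:]"
      by (simp add: Suc straight_image_def shear_const cycle_step)
    show ?thesis
    proof (cases "i < p")
      case True
      then show ?thesis
        unfolding lhs by (simp add: gen_image_def B.hom_add straighten_mvar) (simp add: straight_image_def Suc)
    next
      case False
      then have "Suc k = p" using assms(3) Suc by simp
      then have "(cycle_diff p ^^ Suc k) (mvar 0) = (0 :: 'a mpoly)"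
        using cycle_diff_funpow_p[OF assms(1,2)] by simp
      then show ?thesis
        unfolding lhs using False
        by (simp only: gen_image_def if_False straighten_mvar) (simp add: straight_image_def Suc)
    qed
  qed
qed

lemma shear_straighten:
  assumes "prime p" "CHAR('a::field) = p" "f \<in> poly_ring (p + 1)"
  shows "shear p (straighten p f) = straighten p (gen_act p (f :: 'a mpoly))"
proof -
  interpret B: comm_ring_hom "straighten p :: 'a mpoly \<Rightarrow> _" by (rule comm_ring_hom_straighten)
  interpret S: comm_ring_hom "shear p :: 'a mpoly poly \<Rightarrow> _" by (rule comm_ring_hom_shear)
  have const: "shear p [:mconst c:] = [:mconst c :: 'a mpoly:]" for c
    by (simp add: shear_const cycle_def poly_subst_mconst)
  have "shear p (straighten p f) = eval_hom (\<lambda>c. [:mconst c:]) (\<lambda>i. shear p (straight_image p i)) f"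
    by (subst straighten_def) (simp add: S.hom_eval_hom const)
  also have "\<dots> = eval_hom (\<lambda>c. [:mconst c:]) (\<lambda>i. straighten p (gen_image p i)) f"
    by (rule eval_hom_cong[OF assms(3) shear_straight_image[OF assms(1,2)]])
  also have "\<dots> = straighten p (gen_act p f)"
    by (simp add: gen_act_def poly_subst_eq_eval_hom B.hom_eval_hom straighten_mconst)
  finally show ?thesis .
qed

lemma gen_image_in_hpoly: "i < p + 1 \<Longrightarrow> gen_image p i \<in> hpoly (p + 1) 1"
  unfolding gen_image_def by (auto intro!: hpoly_add hpoly_mvar[unfolded One_nat_def])

lemma gen_in_hpoly: "f \<in> hpoly (p + 1) d \<Longrightarrow> gen_act p f \<in> hpoly (p + 1) d"
  unfolding gen_act_def by (rule poly_subst_in_hpoly) (assumption, rule gen_image_in_hpoly)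

lemma gen_funpow_in_hpoly: "f \<in> hpoly (p + 1) d \<Longrightarrow> (gen_act p ^^ k) f \<in> hpoly (p + 1) d"
proof (induction k)
  case (Suc k)
  then show ?case using gen_in_hpoly[OF Suc.IH] by simp
qed simp

lemma gen_funpow_mvar_in_hpoly: "p > 0 \<Longrightarrow> (gen_act p ^^ k) (mvar 1) \<in> hpoly (p + 1) 1"
  by (rule gen_funpow_in_hpoly, rule hpoly_mvar) simp

lemma gen_diff_funpow_mvar:
  "k < p \<Longrightarrow> ((\<lambda>f. gen_act p f - f) ^^ k) (mvar 1) = mvar (Suc k)"
  by (induction k) (simp_all add: gen_mvar gen_image_def)

lemma gen_funpow_p_mvar:
  assumes "prime p" "CHAR('a::field) = p"
  shows "(gen_act p ^^ p) (mvar 1) = (mvar 1 :: 'a mpoly)"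
proof -
  obtain q where q: "p = Suc q" using prime_gt_0_nat[OF assms(1)] gr0_conv_Suc by auto
  have "((\<lambda>f. gen_act p f - f) ^^ p) (mvar 1) = (gen_act p (mvar p) - mvar p :: 'a mpoly)"
    using gen_diff_funpow_mvar[of q p, where 'a = 'a] by (simp add: q)
  then have "((\<lambda>f. gen_act p f - f) ^^ p) (mvar 1) = (0 :: 'a mpoly)"
    by (simp add: gen_mvar gen_image_def)
  then show ?thesis
    using hom_funpow_prime_char[OF comm_ring_hom_gen_act assms(1), where x = "mvar 1 :: 'a mpoly"] by (simp add: CHAR_mpoly assms(2))
qed

text \<open>The permutation wraps around at \<open>z\<^sub>p\<^sub>-\<^sub>1\<close>; this is compatible with the Jordan block because
  \<open>\<sigma>\<^sup>p x\<^sub>1 = x\<^sub>1\<close>.\<close>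

lemma unstraighten_vars_cycle:
  assumes "prime p" "CHAR('a::field) = p" "f \<in> poly_ring p"
  shows "unstraighten_vars p (cycle p f) = gen_act p (unstraighten_vars p (f :: 'a mpoly))"
proof -
  have "unstraighten_vars p (cycle p f) = poly_subst (\<lambda>i. (gen_act p ^^ cyc p i) (mvar 1)) f"
    by (simp add: unstraighten_vars_def cycle_def poly_subst_subst poly_subst_mvar)
  also have "\<dots> = poly_subst (\<lambda>i. (gen_act p ^^ Suc i) (mvar 1)) f"
  proof (rule poly_subst_cong[OF assms(3)])
    fix i assume "i < p"
    show "(gen_act p ^^ cyc p i) (mvar 1) = ((gen_act p ^^ Suc i) (mvar 1) :: 'a mpoly)"
    proof (cases "Suc i = p")
      case True
      then have "cyc p i = 0" by (simp add: cyc_def)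
      then show ?thesis unfolding True gen_funpow_p_mvar[OF assms(1,2)] by simp
    next
      case False
      then have "cyc p i = Suc i" using \<open>i < p\<close> by (simp add: cyc_def)
      then show ?thesis by simp
    qed
  qed
  also have "\<dots> = gen_act p (unstraighten_vars p f)"
    by (simp add: unstraighten_vars_def gen_act_def poly_subst_subst)
  finally show ?thesis .
qed

lemma hpoly_imp_poly_ring: "f \<in> hpoly n d \<Longrightarrow> f \<in> poly_ring n"
  by (simp add: hpoly_def)

lemma unstraighten_vars_cycle_diff:
  assumes "prime p" "CHAR('a::field) = p" "k < p"
  shows "unstraighten_vars p ((cycle_diff p ^^ k) (mvar 0)) = (mvar (Suc k) :: 'a mpoly)"
proof -
  interpret C: comm_ring_hom "unstraighten_vars p :: 'a mpoly \<Rightarrow> _" by (rule comm_ring_hom_unstraighten_vars)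
  have p: "p > 0" using assms(1) by (rule prime_gt_0_nat)
  have "unstraighten_vars p ((cycle_diff p ^^ k) (mvar 0)) = (((\<lambda>f. gen_act p f - f) ^^ k) (mvar 1) :: 'a mpoly)" for k
  proof (induction k)
    case 0
    show ?case by (simp add: unstraighten_vars_def poly_subst_mvar)
  next
    case (Suc k)
    have "(cycle_diff p ^^ k) (mvar 0) \<in> (poly_ring p :: 'a mpoly set)"
      by (rule hpoly_imp_poly_ring, rule cycle_diff_funpow_in_hpoly[OF p])
    from unstraighten_vars_cycle[OF assms(1,2) this] Suc show ?case
      by (simp add: cycle_diff_def C.hom_minus)
  qed
  then show ?thesis using gen_diff_funpow_mvar[OF assms(3)] by simp
qed

lemma unstraighten_pCons: "unstraighten p (pCons c P) = unstraighten_vars p c + mvar 0 * unstraighten p P"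
proof -
  interpret C: comm_ring_hom "unstraighten_vars p :: 'a mpoly \<Rightarrow> _" by (rule comm_ring_hom_unstraighten_vars)
  show ?thesis by (simp add: unstraighten_def C.map_poly_pCons_hom)
qed

lemma unstraighten_straighten:
  assumes "prime p" "CHAR('a::field) = p" "f \<in> poly_ring (p + 1)"
  shows "unstraighten p (straighten p f) = (f :: 'a mpoly)"
proof -
  interpret A: comm_ring_hom "unstraighten p :: 'a mpoly poly \<Rightarrow> _" by (rule comm_ring_hom_unstraighten)
  interpret C: comm_ring_hom "unstraighten_vars p :: 'a mpoly \<Rightarrow> _" by (rule comm_ring_hom_unstraighten_vars)
  have const: "unstraighten p [:c:] = unstraighten_vars p c" for c :: "'a mpoly"
    using unstraighten_pCons[of p c 0] by simp
  have "unstraighten p (straighten p f) = eval_hom mconst (\<lambda>i. unstraighten p (straight_image p i)) f"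
    by (simp add: straighten_def A.hom_eval_hom const) (simp add: unstraighten_vars_def poly_subst_mconst)
  also have "\<dots> = eval_hom mconst mvar f"
  proof (rule eval_hom_cong[OF assms(3)])
    fix i assume i: "i < p + 1"
    show "unstraighten p (straight_image p i) = (mvar i :: 'a mpoly)"
    proof (cases i)
      case 0
      then show ?thesis by (simp add: straight_image_def unstraighten_pCons)
    next
      case (Suc k)
      then have "k < p" using i by simp
      then show ?thesis
        using unstraighten_vars_cycle_diff[OF assms(1,2)] by (simp add: straight_image_def const Suc)
    qed
  qed
  also have "\<dots> = f" by (simp add: poly_subst_id flip: poly_subst_eq_eval_hom)
  finally show ?thesis .
qed

lemma straighten_unstraighten:
  assumes "prime p" "CHAR('a::field) = p" "\<And>n. coeff P n \<in> poly_ring p"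
  shows "straighten p (unstraighten p P) = (P :: 'a mpoly poly)"
proof -
  interpret B: comm_ring_hom "straighten p :: 'a mpoly \<Rightarrow> _" by (rule comm_ring_hom_straighten)
  interpret K: comm_ring_hom "\<lambda>c :: 'a mpoly. [:c:]" by (rule comm_ring_hom_const_poly)
  interpret A: comm_ring_hom "unstraighten p :: 'a mpoly poly \<Rightarrow> _" by (rule comm_ring_hom_unstraighten)
  have p: "p > 0" using assms(1) by (rule prime_gt_0_nat)
  have vars: "straighten p ((gen_act p ^^ i) (mvar 1)) = ([:(cycle p ^^ i) (mvar 0):] :: 'a mpoly poly)" for i
  proof (induction i)
    case (Suc i)
    have "(gen_act p ^^ i) (mvar 1) \<in> (poly_ring (p + 1) :: 'a mpoly set)"
      by (rule hpoly_imp_poly_ring, rule gen_funpow_mvar_in_hpoly[OF p])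
    from shear_straighten[OF assms(1,2) this] Suc show ?case by (simp add: shear_const)
  qed (simp add: straighten_mvar straight_image_def)
  have const: "straighten p (unstraighten_vars p c) = [:c:]" if "c \<in> poly_ring p" for c :: "'a mpoly"
  proof -
    have "straighten p (unstraighten_vars p c) = eval_hom (\<lambda>c. [:mconst c:]) (\<lambda>i. straighten p ((gen_act p ^^ i) (mvar 1))) c"
      by (simp add: unstraighten_vars_def poly_subst_eq_eval_hom B.hom_eval_hom straighten_mconst)
    also have "\<dots> = eval_hom (\<lambda>c. [:mconst c:]) (\<lambda>i. [:mvar i:]) c"
      by (rule eval_hom_cong[OF that]) (simp only: vars cycle_funpow_mvar[OF p] add_0 mod_less)
    also have "\<dots> = [:poly_subst mvar c:]"
      by (simp add: poly_subst_eq_eval_hom K.hom_eval_hom)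
    finally show ?thesis by (simp add: poly_subst_id)
  qed
  show ?thesis using assms(3)
  proof (induction P rule: pCons_induct)
    case (pCons c P)
    have c: "c \<in> poly_ring p" using pCons.prems[of 0] by simp
    have "coeff P n \<in> poly_ring p" for n using pCons.prems[of "Suc n"] by simp
    then have IH: "straighten p (unstraighten p P) = P" by (rule pCons.IH)
    have "straighten p (unstraighten p (pCons c P)) = [:c:] + [:0, 1:] * P"
      by (simp only: unstraighten_pCons B.hom_add B.hom_mult const[OF c] IH straighten_mvar)
        (simp add: straight_image_def)
    then show ?case by simp
  qed simp
qed

lemma straighten_in_gpoly:
  assumes "f \<in> hpoly (p + 1) d" "p > 0"
  shows "straighten p f \<in> gpoly p d"
  unfolding straighten_def
proof (rule eval_hom_in_graded[where n = "p + 1"])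
  show "straight_image p i \<in> gpoly p 1" for i
    unfolding straight_image_def
    using gpoly_X gpoly_const[OF cycle_diff_funpow_in_hpoly[OF assms(2)]] by (auto split: nat.split)
  show "[:mconst c:] \<in> gpoly p 0" for c :: 'a
    by (rule gpoly_const[OF hpoly_mconst])
qed (use assms(1)[unfolded hpoly_def] in \<open>auto intro: gpoly_add gpoly_mult\<close>)

lemma unstraighten_in_hpoly:
  assumes "P \<in> gpoly p d" "p > 0"
  shows "unstraighten p P \<in> hpoly (p + 1) d"
proof -
  interpret C: comm_ring_hom "unstraighten_vars p :: 'a mpoly \<Rightarrow> _" by (rule comm_ring_hom_unstraighten_vars)
  have deg: "degree (map_poly (unstraighten_vars p) P) \<le> d"
    using assms(1) degree_map_poly_le[of "unstraighten_vars p" P] by (simp add: gpoly_def)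
  have "unstraighten p P = (\<Sum>k\<le>d. unstraighten_vars p (coeff P k) * mvar 0 ^ k)"
    unfolding unstraighten_def poly_altdef C.coeff_map_poly_hom[symmetric]
    using deg by (intro sum.mono_neutral_left) (auto simp del: C.coeff_map_poly_hom simp: coeff_eq_0)
  also have "\<dots> \<in> hpoly (p + 1) d"
  proof (rule hpoly_sum)
    fix k assume k: "k \<in> {..d}"
    then have "coeff P k \<in> hpoly p (d - k)" using assms(1) by (simp add: gpoly_def)
    then have "unstraighten_vars p (coeff P k) \<in> hpoly (p + 1) (d - k)"
      unfolding unstraighten_vars_def by (rule poly_subst_in_hpoly) (rule gen_funpow_mvar_in_hpoly[OF assms(2)])
    moreover have "(mvar 0 :: 'a mpoly) ^ k \<in> hpoly (p + 1) (k * 1)"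
      by (rule hpoly_power, rule hpoly_mvar) simp
    ultimately have "unstraighten_vars p (coeff P k) * mvar 0 ^ k \<in> hpoly (p + 1) ((d - k) + k * 1)"
      by (rule hpoly_mult)
    then show "unstraighten_vars p (coeff P k) * mvar 0 ^ k \<in> hpoly (p + 1) d" using k by simp
  qed
  finally show ?thesis .
qed

section \<open>The dimension of the space of invariants\<close>

context vector_space
begin

text \<open>Triangularity with respect to \<open>r\<close> allows the elements \<open>b\<close> to be corrected, by induction on \<open>r\<close>, to
  a family dual to the functionals; joint injectivity makes it a basis.\<close>

lemma dim_eq_card_if_triangular_functionals:
  fixes l :: "'k \<Rightarrow> 'b \<Rightarrow> 'a" and r :: "'k \<Rightarrow> nat"
  assumes W: "subspace W" and K: "finite K"
    and l_add: "\<And>k x y. l k (x + y) = l k x + l k y"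
    and l_scale: "\<And>k c x. l k (scale c x) = c * l k x"
    and joint_inj: "\<And>x. x \<in> W \<Longrightarrow> (\<And>k. k \<in> K \<Longrightarrow> l k x = 0) \<Longrightarrow> x = 0"
    and triangular: "\<And>k. k \<in> K \<Longrightarrow>
      \<exists>b\<in>W. l k b = 1 \<and> (\<forall>k'\<in>K. r k \<le> r k' \<longrightarrow> k' \<noteq> k \<longrightarrow> l k' b = 0)"
  shows "dim W = card K"
proof -
  have l_zero: "l k 0 = 0" for k using l_scale[of k 0 0] by simp
  have l_sum: "l k (sum f A) = (\<Sum>i\<in>A. l k (f i))" for k and f :: "'k \<Rightarrow> 'b" and A
    by (induction A rule: infinite_finite_induct) (auto simp: l_zero l_add)
  have l_diff: "l k (x - y) = l k x - l k y" for k x y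
    using l_add[of k "x - y" y] by simp
  have dual: "\<exists>b\<in>W. \<forall>k'\<in>K. l k' b = (if k' = k then 1 else 0)" if "k \<in> K" for k
    using that
  proof (induction "r k" arbitrary: k rule: less_induct)
    case less
    let ?L = "{k' \<in> K. r k' < r k}"
    have "\<forall>j\<in>?L. \<exists>b\<in>W. \<forall>k'\<in>K. l k' b = (if k' = j then 1 else 0)" using less.hyps by blast
    then obtain c where c: "\<And>j. j \<in> ?L \<Longrightarrow> c j \<in> W" "\<And>j k'. j \<in> ?L \<Longrightarrow> k' \<in> K \<Longrightarrow> l k' (c j) = (if k' = j then 1 else 0)"
      by metis
    obtain b where b: "b \<in> W" "l k b = 1" "\<And>k'. k' \<in> K \<Longrightarrow> r k \<le> r k' \<Longrightarrow> k' \<noteq> k \<Longrightarrow> l k' b = 0"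
      using triangular[OF less.prems] by blast
    define b' where "b' = b - (\<Sum>j\<in>?L. scale (l j b) (c j))"
    have "b' \<in> W"
      unfolding b'_def using b(1) c(1)
      by (intro subspace_diff[OF W] subspace_sum[OF W] subspace_scale[OF W])
    moreover have "l k' b' = (if k' = k then 1 else 0)" if "k' \<in> K" for k'
    proof -
      have "(\<Sum>j\<in>?L. l j b * l k' (c j)) = (\<Sum>j\<in>?L. if j = k' then l k' b else 0)"
        using c(2)[OF _ that] by (intro sum.cong) auto
      also have "\<dots> = (if k' \<in> ?L then l k' b else 0)"
        using K by (subst sum.delta) auto
      finally have "l k' b' = l k' b - (if k' \<in> ?L then l k' b else 0)"
        by (simp add: b'_def l_diff l_sum l_scale)
      then show ?thesis
        using b(2) b(3)[OF that] that by (cases "k' = k"; cases "r k' < r k") auto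
    qed
    ultimately show ?case by blast
  qed
  then obtain c where c: "\<And>k. k \<in> K \<Longrightarrow> c k \<in> W" "\<And>k k'. k \<in> K \<Longrightarrow> k' \<in> K \<Longrightarrow> l k' (c k) = (if k' = k then 1 else 0)"
    by metis
  have inj: "inj_on c K"
  proof (rule inj_onI)
    fix k k' assume kk: "k \<in> K" "k' \<in> K" "c k = c k'"
    have "l k (c k') = 1" using c(2)[OF kk(1) kk(1)] kk(3) by simp
    then show "k = k'" using c(2)[OF kk(2) kk(1)] by (simp split: if_splits)
  qed
  have l_comb: "l k (\<Sum>j\<in>K. scale (a j) (c j)) = a k" if "k \<in> K" for a k
  proof -
    have "l k (\<Sum>j\<in>K. scale (a j) (c j)) = (\<Sum>j\<in>K. if j = k then a k else 0)"
      unfolding l_sum l_scale using c(2)[OF _ that] by (intro sum.cong) auto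
    then show ?thesis using K that by simp
  qed
  have "independent (c ` K)"
  proof (rule independent_if_scalars_zero)
    fix f x assume 0: "(\<Sum>x\<in>c ` K. scale (f x) x) = 0" and "x \<in> c ` K"
    then obtain k where k: "k \<in> K" "x = c k" by blast
    have "(\<Sum>j\<in>K. scale (f (c j)) (c j)) = 0" using 0 by (simp add: sum.reindex[OF inj])
    then show "f x = 0" using l_comb[OF k(1), of "\<lambda>j. f (c j)"] by (simp add: l_zero k(2))
  qed (use K in simp)
  moreover have "W \<subseteq> span (c ` K)"
  proof
    fix x assume x: "x \<in> W"
    let ?y = "\<Sum>j\<in>K. scale (l j x) (c j)"
    have "x - ?y \<in> W"
      using x c(1) by (intro subspace_diff[OF W] subspace_sum[OF W] subspace_scale[OF W])
    moreover have "l k (x - ?y) = 0" if "k \<in> K" for k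
      by (simp only: l_diff l_comb[OF that]) simp
    ultimately have "x - ?y = 0" by (rule joint_inj)
    then have "x = ?y" by simp
    also have "\<dots> \<in> span (c ` K)" by (intro span_sum span_scale span_base) auto
    finally show "x \<in> span (c ` K)" .
  qed
  moreover have "c ` K \<subseteq> W" using c(1) by blast
  ultimately show ?thesis using dim_unique[of "c ` K" W "card K"] card_image[OF inj] by simp
qed

end

text \<open>This yields the recursion on the number of variables for the number of monomials of a given degree.\<close>

lemma monomials_Suc:
  "bij_betw (\<lambda>(j, m). m + Poly_Mapping.single n j) (SIGMA j:{..e}. monomials n (e - j)) (monomials (Suc n) e)"
proof (rule bij_betw_byWitness[where f' = "\<lambda>m. (Poly_Mapping.lookup m n, m - Poly_Mapping.single n (Poly_Mapping.lookup m n))"])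
  have zero: "Poly_Mapping.lookup m n = 0" if "Poly_Mapping.keys m \<subseteq> {..<n}" for m :: monom
    using that by (auto simp: in_keys_iff)
  have deg_single: "monom_degree (Poly_Mapping.single n j) = j" for j
    by (simp add: monom_degree_def)
  show "\<forall>a\<in>SIGMA j:{..e}. monomials n (e - j).
      (\<lambda>m. (Poly_Mapping.lookup m n, m - Poly_Mapping.single n (Poly_Mapping.lookup m n)))
        ((\<lambda>(j, m). m + Poly_Mapping.single n j) a) = a"
    by (auto simp: monomials_def lookup_add zero)
  have split: "m - Poly_Mapping.single n (Poly_Mapping.lookup m n) + Poly_Mapping.single n (Poly_Mapping.lookup m n) = m" for m :: monom
    by (rule poly_mapping_eqI) (simp add: lookup_add lookup_minus lookup_single when_def)
  then show "\<forall>a'\<in>monomials (Suc n) e. (\<lambda>(j, m). m + Poly_Mapping.single n j)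
      (Poly_Mapping.lookup a' n, a' - Poly_Mapping.single n (Poly_Mapping.lookup a' n)) = a'"
    by simp
  show "(\<lambda>(j, m). m + Poly_Mapping.single n j) ` (SIGMA j:{..e}. monomials n (e - j)) \<subseteq> monomials (Suc n) e"
  proof (rule image_subsetI)
    fix x assume "x \<in> (SIGMA j:{..e}. monomials n (e - j))"
    then obtain j m where "x = (j, m)" "j \<le> e" "m \<in> monomials n (e - j)" by auto
    then show "(\<lambda>(j, m). m + Poly_Mapping.single n j) x \<in> monomials (Suc n) e"
      using Poly_Mapping.keys_add[of m "Poly_Mapping.single n j"]
      by (auto simp: monomials_def monom_degree_add deg_single split: if_splits)
  qed
  show "(\<lambda>m. (Poly_Mapping.lookup m n, m - Poly_Mapping.single n (Poly_Mapping.lookup m n))) ` monomials (Suc n) e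
      \<subseteq> (SIGMA j:{..e}. monomials n (e - j))"
  proof (rule image_subsetI)
    fix m assume m: "m \<in> monomials (Suc n) e"
    let ?j = "Poly_Mapping.lookup m n" and ?m = "m - Poly_Mapping.single n (Poly_Mapping.lookup m n)"
    have "monom_degree ?m + ?j = e"
      using m arg_cong[OF split[of m], of monom_degree] by (simp add: monom_degree_add deg_single monomials_def)
    moreover have "Poly_Mapping.keys ?m \<subseteq> {..<n}"
    proof
      fix i assume i: "i \<in> Poly_Mapping.keys ?m"
      then have "i \<noteq> n" "i \<in> Poly_Mapping.keys m"
        by (auto simp: in_keys_iff lookup_minus lookup_single when_def split: if_splits)
      then show "i \<in> {..<n}" using m by (auto simp: monomials_def less_Suc_eq)
    qed
    ultimately show "(?j, ?m) \<in> (SIGMA j:{..e}. monomials n (e - j))"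
      by (auto simp: monomials_def)
  qed
qed

lemma monomials_0: "monomials 0 e = (if e = 0 then {0} else {})"
  by (auto simp: monomials_def monom_degree_def)

lemma finite_monomials: "finite (monomials n e)"
proof (induction n arbitrary: e)
  case 0
  show ?case by (simp add: monomials_0)
next
  case (Suc n)
  then show ?case using bij_betw_finite[OF monomials_Suc, of e n] by auto
qed

lemma card_monomials_Suc: "card (monomials (Suc n) e) = (\<Sum>j\<le>e. card (monomials n (e - j)))"
  using bij_betw_same_card[OF monomials_Suc, of e n] by (simp add: finite_monomials)

lemma coords_eq_Sigma:
  "bij_betw (\<lambda>(N, m). (m, N)) (SIGMA N:{..d}. {m \<in> monomials p (d - N).
     orbit_min p m \<and> p dvd N \<or> rot p m = m \<and> p\<^sup>2 dvd N}) (coords p d)"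
  by (rule bij_betw_byWitness[where f' = "\<lambda>(m, N). (N, m)"])
    (auto simp: coords_def monomials_def)

lemma finite_coords: "finite (coords p d)"
  using bij_betw_finite[OF coords_eq_Sigma, of d p] finite_monomials by auto

lemma hom_mscale:
  assumes "comm_ring_hom h"
  shows "h (mscale c f) = h (mconst c) * h f"
proof -
  interpret comm_ring_hom h by fact
  show ?thesis by (simp add: mscale_def hom_mult)
qed

text \<open>The functionals are the coefficients of the straightened polynomial at the leading terms in
  \<^const>\<open>coords\<close>, ranked by the exponent of \<open>X\<close>.\<close>

theorem dim_invariants:
  assumes "prime p" "CHAR('a::field) = p"
  shows "mpoly.dim ((V_invariants p :: 'a mpoly set) \<inter> homogeneous d) = card (coords p d)"
proof (rule mpoly.dim_eq_card_if_triangular_functionals[where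
      l = "\<lambda>(m, N) f. Poly_Mapping.lookup (coeff (straighten p f) N) m" and r = snd])
  have p: "p > 0" using assms(1) by (rule prime_gt_0_nat)
  interpret B: comm_ring_hom "straighten p :: 'a mpoly \<Rightarrow> _" by (rule comm_ring_hom_straighten)
  interpret G: comm_ring_hom "gen_act p :: 'a mpoly \<Rightarrow> _" by (rule comm_ring_hom_gen_act)
  have W: "(V_invariants p :: 'a mpoly set) \<inter> homogeneous d = {f \<in> hpoly (p + 1) d. gen_act p f = f}"
    unfolding V_invariants_eq[OF assms(1)] by (auto simp: hpoly_def)
  have scale: "straighten p (mscale c f) = [:mconst c:] * straighten p f" for c and f :: "'a mpoly"
    by (simp add: hom_mscale[OF comm_ring_hom_straighten] straighten_mconst del: mult_pCons_left)
  have gen_mconst: "gen_act p (mconst c) = mconst c" for c :: 'a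
    by (simp add: gen_act_def poly_subst_mconst)
  show "mpoly.subspace ((V_invariants p :: 'a mpoly set) \<inter> homogeneous d)"
    unfolding W
  proof (rule mpoly.subspaceI)
    fix c :: 'a and f :: "'a mpoly" assume f: "f \<in> {f \<in> hpoly (p + 1) d. gen_act p f = f}"
    have "mscale c f \<in> hpoly (p + 1) (0 + d)"
      unfolding mscale_def using f by (intro hpoly_mult hpoly_mconst) simp
    then show "mscale c f \<in> {f \<in> hpoly (p + 1) d. gen_act p f = f}"
      using f by (simp add: mscale_def G.hom_mult gen_mconst)
  qed (auto simp: G.hom_add intro: hpoly_add)
  show "finite (coords p d)" by (rule finite_coords)
  fix k
  show "(case k of (m, N) \<Rightarrow> \<lambda>f. Poly_Mapping.lookup (coeff (straighten p f) N) m) (f + g)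
      = (case k of (m, N) \<Rightarrow> \<lambda>f. Poly_Mapping.lookup (coeff (straighten p f) N) m) f
      + (case k of (m, N) \<Rightarrow> \<lambda>f. Poly_Mapping.lookup (coeff (straighten p f) N) m) g" for f g :: "'a mpoly"
    by (cases k) (simp add: B.hom_add lookup_add)
  have mconst_mult: "Poly_Mapping.lookup (mconst c * g) m = c * Poly_Mapping.lookup g m" for c and g :: "'a mpoly" and m
    using lookup_single_mult[of 0 c g m] by (simp add: mconst_def)
  show "(case k of (m, N) \<Rightarrow> \<lambda>f. Poly_Mapping.lookup (coeff (straighten p f) N) m) (mscale c f)
      = c * (case k of (m, N) \<Rightarrow> \<lambda>f. Poly_Mapping.lookup (coeff (straighten p f) N) m) f" for c and f :: "'a mpoly"
    by (cases k) (simp add: scale mconst_mult)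
  show "f = 0" if f: "f \<in> V_invariants p \<inter> homogeneous d"
    and zero: "\<And>k. k \<in> coords p d \<Longrightarrow> (case k of (m, N) \<Rightarrow> \<lambda>f. Poly_Mapping.lookup (coeff (straighten p f) N) m) f = 0"
    for f :: "'a mpoly"
  proof -
    have f: "f \<in> hpoly (p + 1) d" "gen_act p f = f" using f W by auto
    have ring: "f \<in> poly_ring (p + 1)" by (rule hpoly_imp_poly_ring[OF f(1)])
    have "straighten p f = 0"
    proof (rule invariant_zero_if_coords_zero[OF assms straighten_in_gpoly[OF f(1) p]])
      show "shear p (straighten p f) = straighten p f"
        using shear_straighten[OF assms ring] f(2) by simp
    qed (use zero in force)
    then show ?thesis
      using unstraighten_straighten[OF assms ring] by (simp add: unstraighten_def)
  qed
  show "\<exists>b\<in>V_invariants p \<inter> homogeneous d. (case k of (m, N) \<Rightarrow> \<lambda>f. Poly_Mapping.lookup (coeff (straighten p f) N) m) b = (1 :: 'a) \<and>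
      (\<forall>k'\<in>coords p d. snd k \<le> snd k' \<longrightarrow> k' \<noteq> k \<longrightarrow>
        (case k' of (m, N) \<Rightarrow> \<lambda>f. Poly_Mapping.lookup (coeff (straighten p f) N) m) b = 0)"
    if k: "k \<in> coords p d"
  proof -
    obtain m N where mN: "k = (m, N)" by (cases k)
    obtain Q :: "'a mpoly poly" where Q: "Q \<in> gpoly p d" "shear p Q = Q" "Poly_Mapping.lookup (coeff Q N) m = 1"
      "\<And>m' N'. (m', N') \<in> coords p d \<Longrightarrow> N' \<ge> N \<Longrightarrow> (m', N') \<noteq> (m, N) \<Longrightarrow> Poly_Mapping.lookup (coeff Q N') m' = 0"
      using invariant_with_coord[OF assms k[unfolded mN]] by metis
    let ?f = "unstraighten p Q"
    have f: "?f \<in> hpoly (p + 1) d" by (rule unstraighten_in_hpoly[OF Q(1) p])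
    have coeffs: "coeff Q n \<in> poly_ring p" for n
    proof (cases "n \<le> d")
      case True
      then have "coeff Q n \<in> hpoly p (d - n)" using Q(1) by (simp add: gpoly_def)
      then show ?thesis by (rule hpoly_imp_poly_ring)
    next
      case False
      then have "coeff Q n = 0" using Q(1) by (intro coeff_eq_0) (simp add: gpoly_def)
      then show ?thesis by (simp add: poly_ring_def)
    qed
    have B: "straighten p ?f = Q" by (rule straighten_unstraighten[OF assms coeffs])
    have "gen_act p ?f = unstraighten p (straighten p (gen_act p ?f))"
      by (rule unstraighten_straighten[OF assms, symmetric], rule hpoly_imp_poly_ring, rule gen_in_hpoly[OF f])
    also have "straighten p (gen_act p ?f) = Q"
      using shear_straighten[OF assms hpoly_imp_poly_ring[OF f]] B Q(2) by simp
    finally have "?f \<in> V_invariants p \<inter> homogeneous d" unfolding W using f by simp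
    moreover have "(case k' of (m, N) \<Rightarrow> \<lambda>f. Poly_Mapping.lookup (coeff (straighten p f) N) m) ?f = 0"
      if "k' \<in> coords p d" "snd k \<le> snd k'" "k' \<noteq> k" for k'
      using Q(4)[of "fst k'" "snd k'"] that by (cases k') (simp add: mN B)
    ultimately show ?thesis using Q(3) by (intro bexI[of _ ?f]) (auto simp: mN B)
  qed
qed

section \<open>Generating functions\<close>

text \<open>The expansion of \<open>1 / (1 - x\<^sup>q)\<close>.\<close>

definition multiples_fps :: "nat \<Rightarrow> rat fps" where
  "multiples_fps q = Abs_fps (\<lambda>n. if q dvd n then 1 else 0)"

lemma multiples_fps_inverse:
  assumes "q > 0"
  shows "(1 - fps_X ^ q) * multiples_fps q = 1"
proof (rule fps_ext)
  fix n
  have nth: "fps_nth ((1 - fps_X ^ q) * multiples_fps q) n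
      = (if q dvd n then 1 else 0) - (if n < q then 0 else if q dvd n - q then 1 else 0)"
    by (simp add: left_diff_distrib fps_X_power_mult_nth multiples_fps_def)
  show "fps_nth ((1 - fps_X ^ q) * multiples_fps q) n = fps_nth 1 n"
  proof (cases "n < q")
    case True
    then have "q dvd n \<longleftrightarrow> n = 0" using nat_dvd_not_less by auto
    then show ?thesis using True unfolding nth by simp
  next
    case False
    then have "q dvd n - q \<longleftrightarrow> q dvd n" "n \<noteq> 0" using assms by (auto simp: dvd_minus_self)
    then show ?thesis using False unfolding nth by simp
  qed
qed

lemma fps_card_monomials: "Abs_fps (\<lambda>e. of_nat (card (monomials n e))) * (1 - fps_X) ^ n = (1 :: rat fps)"
proof (induction n)
  case 0
  show ?case by (rule fps_ext) (simp add: monomials_0)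
next
  case (Suc n)
  have "Abs_fps (\<lambda>e. of_nat (card (monomials (Suc n) e))) = multiples_fps 1 * Abs_fps (\<lambda>e. of_nat (card (monomials n e)))"
    by (rule fps_ext) (simp add: card_monomials_Suc fps_mult_nth multiples_fps_def atLeast0AtMost)
  then have "Abs_fps (\<lambda>e. of_nat (card (monomials (Suc n) e))) * (1 - fps_X) ^ Suc n
      = ((1 - fps_X ^ 1) * multiples_fps 1) * (Abs_fps (\<lambda>e. of_nat (card (monomials n e))) * (1 - fps_X) ^ n)"
    by (simp add: mult_ac)
  moreover have "(1 - fps_X ^ 1) * multiples_fps 1 = 1" by (rule multiples_fps_inverse) simp
  ultimately show ?case by (simp only: Suc mult_1_left)
qed

lemma card_rot_fixed_monomials:
  assumes "p > 0"
  shows "card {m \<in> monomials p e. rot p m = m} = (if p dvd e then 1 else 0)"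
proof -
  have "{m \<in> monomials p e. rot p m = m} = (if p dvd e then {const_monom p (e div p)} else {})"
    using assms rot_fixed_iff[of _ p] keys_const_monom[of p] monom_degree_const_monom[of p]
    by (auto simp: monomials_def)
  then show ?thesis by simp
qed

lemma card_monomials_split:
  assumes "prime p"
  shows "card (monomials p e) = (if p dvd e then 1 else 0) + p * card {m \<in> monomials p e. orbit_min p m}"
proof -
  have p: "p > 0" using assms by (rule prime_gt_0_nat)
  have "monomials p e = {m \<in> monomials p e. rot p m = m} \<union> {m \<in> monomials p e. rot p m \<noteq> m}" by auto
  then have "card (monomials p e) = card {m \<in> monomials p e. rot p m = m} + card {m \<in> monomials p e. rot p m \<noteq> m}"
    using finite_monomials[of p e] by (subst card_Un_disjoint[symmetric]) auto
  then show ?thesis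
    by (simp only: card_nonfixed_monomials[OF assms] card_rot_fixed_monomials[OF p])
qed

lemma card_coords:
  assumes "p > 0"
  shows "card (coords p d) = (\<Sum>N\<le>d. (if p dvd N then card {m \<in> monomials p (d - N). orbit_min p m} else 0)
    + (if p\<^sup>2 dvd N then if p dvd d - N then 1 else 0 else 0))"
proof -
  have "card {m \<in> monomials p e. orbit_min p m \<and> p dvd N \<or> rot p m = m \<and> p\<^sup>2 dvd N}
    = (if p dvd N then card {m \<in> monomials p e. orbit_min p m} else 0)
    + (if p\<^sup>2 dvd N then if p dvd e then 1 else 0 else 0)" for e N
  proof -
    have "{m \<in> monomials p e. orbit_min p m \<and> p dvd N \<or> rot p m = m \<and> p\<^sup>2 dvd N}
      = (if p dvd N then {m \<in> monomials p e. orbit_min p m} else {})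
      \<union> (if p\<^sup>2 dvd N then {m \<in> monomials p e. rot p m = m} else {})"
      by auto
    then have "card {m \<in> monomials p e. orbit_min p m \<and> p dvd N \<or> rot p m = m \<and> p\<^sup>2 dvd N}
      = card (if p dvd N then {m \<in> monomials p e. orbit_min p m} else {})
      + card (if p\<^sup>2 dvd N then {m \<in> monomials p e. rot p m = m} else {})"
      using finite_monomials[of p e] by (simp only:) (rule card_Un_disjoint, auto simp: orbit_min_def)
    then show ?thesis by (simp add: card_rot_fixed_monomials[OF assms] if_distrib[of card])
  qed
  then show ?thesis
    using bij_betw_same_card[OF coords_eq_Sigma, of d p] by (simp add: finite_monomials)
qed

lemma hilbert_series_V_invariants:
  assumes "prime p" "CHAR('a::field) = p"
  shows "hilbert_series (V_invariants p :: 'a mpoly set) =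
    multiples_fps p * Abs_fps (\<lambda>e. of_nat (card {m \<in> monomials p e. orbit_min p m}))
    + multiples_fps (p\<^sup>2) * multiples_fps p"
proof (rule fps_ext)
  fix d
  have p: "p > 0" using assms(1) by (rule prime_gt_0_nat)
  let ?c = "\<lambda>e. card {m \<in> monomials p e. orbit_min p m}"
  have "fps_nth (hilbert_series (V_invariants p :: 'a mpoly set)) d = of_nat (card (coords p d))"
    by (simp add: hilbert_series_def dim_invariants[OF assms])
  also have "\<dots> = (\<Sum>N\<le>d. (if p dvd N then 1 else 0) * of_nat (?c (d - N)))
      + (\<Sum>N\<le>d. (if p\<^sup>2 dvd N then 1 else 0) * (if p dvd d - N then 1 else 0))"
    unfolding card_coords[OF p] of_nat_sum sum.distrib[symmetric] by (intro sum.cong) auto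
  also have "\<dots> = fps_nth (multiples_fps p * Abs_fps (\<lambda>e. of_nat (?c e)) + multiples_fps (p\<^sup>2) * multiples_fps p) d"
    by (simp add: fps_mult_nth multiples_fps_def atLeast0AtMost)
  finally show "fps_nth (hilbert_series (V_invariants p :: 'a mpoly set)) d
    = fps_nth (multiples_fps p * Abs_fps (\<lambda>e. of_nat (?c e)) + multiples_fps (p\<^sup>2) * multiples_fps p) d" .
qed

theorem mainTheorem5:
  fixes p :: nat
  assumes "prime p" and "CHAR('a::field) = p"
  shows "hilbert_series (V_invariants p :: 'a mpoly set) =
    1 / (of_nat p * (1 - fps_X ^ p)) *
      (1 / (1 - fps_X) ^ p +
       ((of_nat p - 1) - of_nat p * fps_X ^ p + fps_X ^ p\<^sup>2) /
         ((1 - fps_X ^ p) * (1 - fps_X ^ p\<^sup>2)))"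
proof -
  have p: "p > 0" using assms(1) by (rule prime_gt_0_nat)
  define P :: "rat fps" where "P = of_nat p"
  define a :: "rat fps" where "a = 1 - fps_X ^ p"
  define b :: "rat fps" where "b = 1 - fps_X ^ p\<^sup>2"
  define c :: "rat fps" where "c = (1 - fps_X) ^ p"
  define A where "A = multiples_fps p"
  define B where "B = multiples_fps (p\<^sup>2)"
  define F :: "rat fps" where "F = Abs_fps (\<lambda>e. of_nat (card {m \<in> monomials p e. orbit_min p m}))"
  define M :: "rat fps" where "M = Abs_fps (\<lambda>e. of_nat (card (monomials p e)))"
  have aA: "a * A = 1" unfolding a_def A_def by (rule multiples_fps_inverse[OF p])
  have bB: "b * B = 1" unfolding b_def B_def using p by (intro multiples_fps_inverse) simp
  have Mc: "M * c = 1" unfolding M_def c_def by (rule fps_card_monomials)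
  have M: "M = A + P * F"
    by (rule fps_ext) (simp add: M_def A_def P_def F_def multiples_fps_def card_monomials_split[OF assms(1)]
        fps_of_nat[symmetric] del: fps_of_nat)
  have div: "g / (x :: rat fps) = g * y" if "x * y = 1" for g x y
  proof -
    have "g * y * x = g" using that by (simp add: mult_ac)
    moreover have "x \<noteq> 0" using that by auto
    ultimately show ?thesis by (metis nonzero_mult_div_cancel_right)
  qed
  define Q where "Q = fps_const (1 / of_nat p :: rat)"
  have PQ: "P * Q = 1"
    using p by (simp add: P_def Q_def fps_of_nat[symmetric] del: fps_of_nat)
  \<comment> \<open>This form of the numerator splits the second fraction into \<open>P / b - 1 / a\<close>.\<close>
  have num: "P - 1 - P * fps_X ^ p + fps_X ^ p\<^sup>2 = P * a - b"
    by (simp add: a_def b_def algebra_simps)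
  have "(P * a) * (Q * A) = (P * Q) * (a * A)" "(a * b) * (A * B) = (a * A) * (b * B)"
    by (simp_all only: mult_ac)
  then have "(P * a) * (Q * A) = 1" "(a * b) * (A * B) = 1"
    by (simp_all add: PQ aA bB)
  moreover have "c * M = 1" using Mc by (simp only: mult.commute)
  ultimately have "1 / (P * a) * (1 / c + (P * a - b) / (a * b)) = (Q * A) * (M + (P * a - b) * (A * B))"
    by (simp only: div mult_1_left)
  also have "\<dots> = A * F + B * A"
  proof -
    have "(P * a - b) * (A * B) = P * (a * A) * B - (b * B) * A" by (simp add: algebra_simps)
    then have *: "(P * a - b) * (A * B) = P * B - A" by (simp add: aA bB)
    have "(Q * A) * (M + (P * a - b) * (A * B)) = (P * Q) * (A * (F + B))"
      unfolding * M by (simp add: algebra_simps)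
    then show ?thesis by (simp add: PQ algebra_simps)
  qed
  also have "\<dots> = hilbert_series (V_invariants p :: 'a mpoly set)"
    unfolding hilbert_series_V_invariants[OF assms] A_def B_def F_def ..
  finally show ?thesis
    unfolding num[symmetric] unfolding P_def a_def b_def c_def by (rule sym)
qed

end
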